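(* Let $\Sigma\subset\mathbb P^{n+3}$ be a nondegenerate ruled hypersurface of codimension 2. Then $\Sigma$ is the ruled hypersurface of some system of $n$ conservation laws $$u^i_t=\frac{d}{dx}f^i(u),\qquad i=1,\dots,n,$$ admitting two additional independent conservation laws $B(u)\,dx+A(u)\,dt$ and $N(u)\,dx+M(u)\,dt$, if and only if the projective tangent spaces to $\Sigma$ are stable along the line generators of $\Sigma$ (that is, the projective tangent space to $\Sigma$ is the same at all points of a given line generator).
   Context: All considerations are local and smooth, over $\mathbb R$. Geometric objects in $\mathbb P^{n+3}$ are considered up to projective equivalence. A "ruled hypersurface of codimension 2" in $\mathbb P^{n+3}$ is an $(n+1)$-dimensional submanifold swept out by an $n$-parameter family of projective lines, called its (line) generators; tangent spaces are taken at the points where $\Sigma$ is smooth. It is called nondegenerate if it does not lie in any hyperplane. For a system of conservation laws $u^i_t=\frac{d}{dx}f^i(u)$, $i=1,\dots,n$, with $u=(u^1,\dots,u^n)$, an additional conservation law is a one-form $B(u)\,dx+A(u)\,dt$ that is closed on each solution $u(x,t)$; equivalently $\partial_iA=\sum_k \partial_kB\,\partial_i f^k$ for all $i$, where $\partial_i=\partial/\partial u^i$. Two additional conservation laws $B\,dx+A\,dt$, $N\,dx+M\,dt$ are called independent if the $n+4$ one-forms $dx$, $dt$, $u^i\,dx+f^i(u)\,dt$ ($i=1,\dots,n$), $B\,dx+A\,dt$, $N\,dx+M\,dt$, viewed as one-forms in the $(n+2)$-dimensional space with coordinates $(u,x,t)$, are linearly independent over $\mathbb R$. The ruled hypersurface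 of a system with two such additional conservation laws is the union of the $n$-parameter family of lines in $\mathbb P^{n+3}$ (homogeneous coordinates $[Y^0:\dots:Y^{n+3}]$), parametrized by $u$: $$Y^i=u^iY^0+f^i(u)Y^{n+3}\ (i=1,\dots,n),\quad Y^{n+1}=B(u)Y^0+A(u)Y^{n+3},\quad Y^{n+2}=N(u)Y^0+M(u)Y^{n+3};$$ these lines are its generators. *)

theory Defs
  imports "HOL-Analysis.Analysis"
begin

section \<open>Smooth maps\<close>

text \<open>The class \<open>C\<^sup>k\<close> on an open set, by iterated directional derivatives.\<close>

primrec Ck_on ::
  "nat \<Rightarrow> 'a::euclidean_space set \<Rightarrow> ('a \<Rightarrow> 'b::real_normed_vector) \<Rightarrow> bool"
where
  "Ck_on 0 S F \<longleftrightarrow> continuous_on S F"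
| "Ck_on (Suc k) S F \<longleftrightarrow>
     (\<forall>x\<in>S. F differentiable (at x)) \<and>
     (\<forall>h. Ck_on k S (\<lambda>x. frechet_derivative F (at x) h))"

definition smooth_on ::
  "'a::euclidean_space set \<Rightarrow> ('a \<Rightarrow> 'b::real_normed_vector) \<Rightarrow> bool"
where
  "smooth_on S F \<longleftrightarrow> (\<forall>k. Ck_on k S F)"

definition pderiv_at :: "'n::finite \<Rightarrow> (real^'n \<Rightarrow> real) \<Rightarrow> real^'n \<Rightarrow> real" where
  "pderiv_at i G u = frechet_derivative G (at u) (axis i 1)"


section \<open>Ruled hypersurfaces of codimension 2\<close>

text \<open>
  With \<open>n = CARD('n)\<close>, the type below is an \<open>(n+4)\<close>-dimensional real vector space, with
  coordinates ordered as \<open>(Y\<^sup>0, (Y\<^sup>1,\<dots>,Y\<^sup>n), Y\<^bsup>n+1\<^esup>, Y\<^bsup>n+2\<^esup>, Y\<^bsup>n+3\<^esup>)\<close>.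
  Its projectivization is the \<open>(n+3)\<close>-dimensional projective space. Projective subspaces of
  dimension \<open>d\<close> are represented by linear subspaces of dimension \<open>d + 1\<close>.
\<close>

type_synonym 'n hcoords = "real \<times> (real^'n) \<times> real \<times> real \<times> real"

text \<open>
  A ruled hypersurface is given by smooth homogeneous vectors \<open>p v\<close>, \<open>q v\<close> spanning the
  generator with parameter \<open>v\<close>.
\<close>

definition generator ::
  "(real^'n::finite \<Rightarrow> 'n hcoords) \<Rightarrow> (real^'n \<Rightarrow> 'n hcoords) \<Rightarrow> real^'n \<Rightarrow> 'n hcoords set"
where
  "generator p q v = span {p v, q v}"

definition ruled_param ::
  "(real^'n::finite \<Rightarrow> 'n hcoords) \<Rightarrow> (real^'n \<Rightarrow> 'n hcoords) \<Rightarrow>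
   (real^'n) \<times> real \<times> real \<Rightarrow> 'n hcoords"
where
  "ruled_param p q = (\<lambda>(v, s, t). s *\<^sub>R p v + t *\<^sub>R q v)"

text \<open>
  The linear subspace below is the projective tangent space at the point \<open>[s p(v) + t q(v)]\<close>.
  The map \<open>(v, [s:t]) \<mapsto> [s p(v) + t q(v)]\<close> is an immersion at \<open>(v, [s:t])\<close> iff this
  subspace has dimension \<open>n + 2\<close>; these are the smooth points of the hypersurface.
\<close>

definition tangent_space ::
  "(real^'n::finite \<Rightarrow> 'n hcoords) \<Rightarrow> (real^'n \<Rightarrow> 'n hcoords) \<Rightarrow> real^'n \<Rightarrow> real \<Rightarrow> real \<Rightarrow> 'n hcoords set"
where
  "tangent_space p q v s t = range (frechet_derivative (ruled_param p q) (at (v, s, t)))"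

definition smooth_point ::
  "(real^'n::finite \<Rightarrow> 'n hcoords) \<Rightarrow> (real^'n \<Rightarrow> 'n hcoords) \<Rightarrow> real^'n \<Rightarrow> real \<Rightarrow> real \<Rightarrow> bool"
where
  "smooth_point p q v s t \<longleftrightarrow>
     (s, t) \<noteq> (0, 0) \<and> dim (tangent_space p q v s t) = CARD('n) + 2"

definition ruled_hypersurface ::
  "(real^'n::finite) set \<Rightarrow> (real^'n \<Rightarrow> 'n hcoords) \<Rightarrow> (real^'n \<Rightarrow> 'n hcoords) \<Rightarrow> bool"
where
  "ruled_hypersurface U p q \<longleftrightarrow>
     open U \<and> smooth_on U p \<and> smooth_on U q \<and>
     (\<forall>v\<in>U. dim (generator p q v) = 2) \<and>
     (\<forall>v\<in>U. \<exists>s t. smooth_point p q v s t)"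

definition nondegenerate ::
  "(real^'n::finite) set \<Rightarrow> (real^'n \<Rightarrow> 'n hcoords) \<Rightarrow> (real^'n \<Rightarrow> 'n hcoords) \<Rightarrow> bool"
where
  "nondegenerate V p q \<longleftrightarrow>
     \<not> (\<exists>a. a \<noteq> 0 \<and> (\<Union>v\<in>V. generator p q v) \<subseteq> {y. a \<bullet> y = 0})"

definition stable_tangent_spaces ::
  "(real^'n::finite) set \<Rightarrow> (real^'n \<Rightarrow> 'n hcoords) \<Rightarrow> (real^'n \<Rightarrow> 'n hcoords) \<Rightarrow> bool"
where
  "stable_tangent_spaces V p q \<longleftrightarrow>
     (\<forall>v\<in>V. \<forall>s t s' t'. smooth_point p q v s t \<longrightarrow> smooth_point p q v s' t' \<longrightarrow>
        tangent_space p q v s t = tangent_space p q v s' t')"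


section \<open>Systems of conservation laws\<close>

definition additional_conservation_law ::
  "(real^'n::finite) set \<Rightarrow> (real^'n \<Rightarrow> real^'n) \<Rightarrow> (real^'n \<Rightarrow> real) \<Rightarrow> (real^'n \<Rightarrow> real) \<Rightarrow> bool"
where
  "additional_conservation_law W f B A \<longleftrightarrow>
     smooth_on W B \<and> smooth_on W A \<and>
     (\<forall>u\<in>W. \<forall>i. pderiv_at i A u = (\<Sum>k\<in>UNIV. pderiv_at k B u * pderiv_at i (\<lambda>w. f w $ k) u))"

text \<open>
  The form \<open>P(u) dx + Q(u) dt\<close> on the space with coordinates \<open>(u, x, t)\<close>: first argument
  the base point, second argument the tangent vector.
\<close>

definition dx_dt_form ::
  "(real^'n::finite \<Rightarrow> real) \<Rightarrow> (real^'n \<Rightarrow> real) \<Rightarrow>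
   (real^'n) \<times> real \<times> real \<Rightarrow> (real^'n) \<times> real \<times> real \<Rightarrow> real"
where
  "dx_dt_form P Q = (\<lambda>(u, x, t) (du, dx, dt). P u * dx + Q u * dt)"

definition independent_laws ::
  "(real^'n::finite) set \<Rightarrow> (real^'n \<Rightarrow> real^'n) \<Rightarrow> (real^'n \<Rightarrow> real) \<Rightarrow> (real^'n \<Rightarrow> real) \<Rightarrow>
   (real^'n \<Rightarrow> real) \<Rightarrow> (real^'n \<Rightarrow> real) \<Rightarrow> bool"
where
  "independent_laws W f B A N M \<longleftrightarrow>
     (\<forall>a b c d e.
        (\<forall>z \<in> W \<times> UNIV. \<forall>h.
           a * dx_dt_form (\<lambda>_. 1) (\<lambda>_. 0) z h + b * dx_dt_form (\<lambda>_. 0) (\<lambda>_. 1) z h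
           + (\<Sum>i\<in>UNIV. c i * dx_dt_form (\<lambda>u. u $ i) (\<lambda>u. f u $ i) z h)
           + d * dx_dt_form B A z h + e * dx_dt_form N M z h = 0)
        \<longrightarrow> a = 0 \<and> b = 0 \<and> (\<forall>i. c i = 0) \<and> d = 0 \<and> e = 0)"

definition system_with_two_laws ::
  "(real^'n::finite) set \<Rightarrow> (real^'n \<Rightarrow> real^'n) \<Rightarrow> (real^'n \<Rightarrow> real) \<Rightarrow> (real^'n \<Rightarrow> real) \<Rightarrow>
   (real^'n \<Rightarrow> real) \<Rightarrow> (real^'n \<Rightarrow> real) \<Rightarrow> bool"
where
  "system_with_two_laws W f B A N M \<longleftrightarrow>
     open W \<and> smooth_on W f \<and>
     additional_conservation_law W f B A \<and> additional_conservation_law W f N M \<and>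
     independent_laws W f B A N M"

definition system_line ::
  "(real^'n::finite \<Rightarrow> real^'n) \<Rightarrow> (real^'n \<Rightarrow> real) \<Rightarrow> (real^'n \<Rightarrow> real) \<Rightarrow>
   (real^'n \<Rightarrow> real) \<Rightarrow> (real^'n \<Rightarrow> real) \<Rightarrow> real^'n \<Rightarrow> 'n hcoords set"
where
  "system_line f B A N M u =
     {(Y0, Y, Yb, Yn, Y3).
        (\<forall>i. Y $ i = u $ i * Y0 + f u $ i * Y3) \<and>
        Yb = B u * Y0 + A u * Y3 \<and> Yn = N u * Y0 + M u * Y3}"

text \<open>
  Up to a projective transformation \<open>g\<close>, both ruled hypersurfaces have the same generators.
  Equality of the swept out point sets would be too weak, because a hypersurface may carry several
  rulings. The parameters \<open>v\<close> and \<open>u\<close> need not agree.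
\<close>

definition hypersurface_of_system ::
  "(real^'n::finite) set \<Rightarrow> (real^'n \<Rightarrow> 'n hcoords) \<Rightarrow> (real^'n \<Rightarrow> 'n hcoords) \<Rightarrow> bool"
where
  "hypersurface_of_system V p q \<longleftrightarrow>
     (\<exists>(W :: (real^'n) set) f B A N M (g :: 'n hcoords \<Rightarrow> 'n hcoords).
        system_with_two_laws W f B A N M \<and> linear g \<and> bij g \<and>
        generator p q ` V = (\<lambda>u. g ` system_line f B A N M u) ` W)"

text \<open>
  The identity in \<^const>\<open>additional_conservation_law\<close> makes \<open>B dx + A dt\<close> closed on every
  solution \<open>u(x, t)\<close> of \<open>u\<^sub>t = f(u)\<^sub>x\<close>.
\<close>

lemma additional_conservation_law_closed:
  fixes u :: "real \<times> real \<Rightarrow> real^'n::finite"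
  assumes "smooth_on W f" "additional_conservation_law W f B A"
    and "u differentiable (at z)" "u z \<in> W"
    and sol: "frechet_derivative u (at z) (0, 1) = frechet_derivative (\<lambda>z. f (u z)) (at z) (1, 0)"
  shows "frechet_derivative (\<lambda>z. B (u z)) (at z) (0, 1) = frechet_derivative (\<lambda>z. A (u z)) (at z) (1, 0)"
proof -
  have Ck: "G differentiable (at (u z))" if "smooth_on W G" for G :: "real^'n \<Rightarrow> 'b::real_normed_vector"
    using that[unfolded smooth_on_def, THEN spec[where x="Suc 0"]] \<open>u z \<in> W\<close> by simp
  have dB: "B differentiable (at (u z))" and dA: "A differentiable (at (u z))"
    and df: "f differentiable (at (u z))"
    using assms(1,2) by (auto intro!: Ck simp: additional_conservation_law_def)
  define DB DA Df Du where "DB = frechet_derivative B (at (u z))"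
    and "DA = frechet_derivative A (at (u z))" and "Df = frechet_derivative f (at (u z))"
    and "Du = frechet_derivative u (at z)"
  have hB: "(B has_derivative DB) (at (u z))" and hA: "(A has_derivative DA) (at (u z))"
    and hf: "(f has_derivative Df) (at (u z))" and hu: "(u has_derivative Du) (at z)"
    unfolding DB_def DA_def Df_def Du_def
    using dB dA df assms(3) by (auto simp: frechet_derivative_works)
  have chain: "frechet_derivative (\<lambda>z. G (u z)) (at z) = (\<lambda>h. DG (Du h))"
    if "(G has_derivative DG) (at (u z))" for G :: "real^'n \<Rightarrow> 'c::real_normed_vector" and DG
    using has_derivative_compose[OF hu that] by (metis frechet_derivative_at)
  have fk: "pderiv_at i (\<lambda>w. f w $ k) (u z) = Df (axis i 1) $ k" for i k
  proof -
    have "((\<lambda>w. f w $ k) has_derivative (\<lambda>h. Df h $ k)) (at (u z))"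
      by (rule bounded_linear.has_derivative[OF bounded_linear_vec_nth hf])
    then show ?thesis unfolding pderiv_at_def by (metis frechet_derivative_at)
  qed
  have expand: "D y = (\<Sum>k\<in>UNIV. D (axis k 1) * y $ k)" if "linear D"
    for D :: "real^'n \<Rightarrow> real" and y
  proof -
    have "D y = D (\<Sum>k\<in>UNIV. y $ k *s axis k 1)" by (simp add: basis_expansion)
    also have "\<dots> = (\<Sum>k\<in>UNIV. D (axis k 1) * y $ k)"
      by (simp add: linear_sum[OF that] scalar_mult_eq_scaleR linear_cmul[OF that] mult.commute)
    finally show ?thesis .
  qed
  note lin = hB[THEN has_derivative_linear] hA[THEN has_derivative_linear] hf[THEN has_derivative_linear]
  have "DA (axis i 1) = DB (Df (axis i 1))" for i
  proof -
    have "DA (axis i 1) = (\<Sum>k\<in>UNIV. DB (axis k 1) * Df (axis i 1) $ k)"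
      using assms(2,4) fk[of i] unfolding additional_conservation_law_def
      by (simp add: pderiv_at_def DA_def DB_def)
    then show ?thesis by (simp only: expand[OF lin(1), of "Df (axis i 1)"])
  qed
  then have "DA y = DB (Df y)" for y
    unfolding expand[OF lin(2), of y]
      expand[OF linear_compose[OF lin(3,1)], of y, unfolded o_def] by (simp only:)
  then show ?thesis
    using sol unfolding chain[OF hB] chain[OF hA] chain[OF hf] by (simp flip: Du_def)
qed

end

theory Submission
  imports Defs
begin

text \<open>
  After a projective transformation the generators near a given one can be spanned by
  \<open>P = (1, y, b, n, 0)\<close> and \<open>Q = (0, z, a, m, 1)\<close>, with \<open>y\<close>, \<open>z\<close> vector valued and all entries smooth
  functions of the parameter. Modulo the generator, the tangent space at \<open>s P + t Q\<close> is the range of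
  \<open>s dP + t dQ\<close>. For a system, \<open>u = y\<close> and the conservation laws say exactly that every \<open>dQ\<close> is of
  the form \<open>(0, k, B'k, N'k, 0)\<close>, as is every \<open>dP\<close>; so all smooth points of a line share the
  \<open>(n + 2)\<close>-dimensional space spanned by the line and these vectors. Conversely, the coordinates can be
  adapted so that \<open>dy = id\<close> at the given line; then \<open>P\<close> and \<open>P + \<epsilon> Q\<close> are smooth points for small
  \<open>\<epsilon>\<close>, stability forces the range of \<open>dQ\<close> into that of \<open>dP\<close>, and with \<open>y\<close> taken as
  the parameter (inverse function theorem) this inclusion is the pair of conservation laws. A linear
  relation between the laws would put the generators in a hyperplane.
\<close>

section \<open>Maps of class \<open>C\<^sup>k\<close>\<close>

text \<open>Derivatives at points of an open set depend only on the values there, so agreement on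
  \<open>S\<close> passes down the recursion.\<close>

lemma Ck_on_cong:
  assumes "open S" "\<And>x. x \<in> S \<Longrightarrow> F x = G x" "Ck_on k S F"
  shows "Ck_on k S G"
  using assms(2,3)
proof (induction k arbitrary: F G)
  case 0
  then show ?case using continuous_on_cong[OF refl, of S F G] by simp
next
  case (Suc k)
  have d: "(G has_derivative frechet_derivative F (at x)) (at x)" if "x \<in> S" for x
  proof (rule has_derivative_transform_within_open[OF _ \<open>open S\<close> that])
    show "(F has_derivative frechet_derivative F (at x)) (at x)"
      using Suc.prems(2) that by (simp add: frechet_derivative_works)
  qed (rule Suc.prems(1))
  have "Ck_on k S (\<lambda>x. frechet_derivative G (at x) h)" for h
  proof (rule Suc.IH)
    show "frechet_derivative F (at x) h = frechet_derivative G (at x) h" if "x \<in> S" for x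
      by (rule fun_cong[OF frechet_derivative_at[OF d[OF that]]])
    show "Ck_on k S (\<lambda>x. frechet_derivative F (at x) h)" using Suc.prems by simp
  qed
  then show ?case using d unfolding Ck_on.simps(2) differentiable_def by blast
qed

text \<open>Derivatives at a point are unique, so an explicit formula \<open>F'\<close> may stand in
  for \<open>frechet_derivative\<close>; this is how the usual rules of calculus enter the closure
  properties below.\<close>

lemma Ck_on_SucI:
  assumes "open S" and d: "\<And>x. x \<in> S \<Longrightarrow> (F has_derivative F' x) (at x)"
    and "\<And>h. Ck_on k S (\<lambda>x. F' x h)"
  shows "Ck_on (Suc k) S F"
proof -
  have "Ck_on k S (\<lambda>x. frechet_derivative F (at x) h)" for h
    by (rule Ck_on_cong[OF assms(1) _ assms(3)[of h]]) (rule fun_cong[OF frechet_derivative_at[OF d]])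
  then show ?thesis using d unfolding Ck_on.simps(2) differentiable_def by blast
qed

lemma Ck_on_Suc_deriv:
  assumes "Ck_on (Suc k) S F" "x \<in> S"
  shows "(F has_derivative frechet_derivative F (at x)) (at x)"
  using assms by (simp add: frechet_derivative_works)

lemma Ck_on_SucD: "Ck_on (Suc k) S F \<Longrightarrow> Ck_on k S F"
proof (induction k arbitrary: F)
  case 0
  then show ?case
    by (auto intro!: differentiable_imp_continuous_on differentiable_at_imp_differentiable_on)
next
  case (Suc k)
  from Suc.prems have "\<forall>x\<in>S. F differentiable (at x)"
    and "\<And>h. Ck_on (Suc k) S (\<lambda>x. frechet_derivative F (at x) h)"
    using Ck_on.simps(2)[of "Suc k" S F] by blast+
  then show ?case using Suc.IH Ck_on.simps(2)[of k S F] by blast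
qed

lemma Ck_on_subset: "Ck_on k S F \<Longrightarrow> T \<subseteq> S \<Longrightarrow> Ck_on k T F"
proof (induction k arbitrary: F)
  case 0
  then show ?case using continuous_on_subset by simp
next
  case (Suc k)
  then show ?case unfolding Ck_on.simps(2) by blast
qed

lemma Ck_on_const: "open S \<Longrightarrow> Ck_on k S (\<lambda>x. c)"
proof (induction k arbitrary: c)
  case (Suc k)
  show ?case by (rule Ck_on_SucI[where F' = "\<lambda>x h. 0"]) (auto intro: Suc)
qed auto

lemma Ck_on_bounded_linear:
  assumes "open S" "bounded_linear L" "Ck_on k S F"
  shows "Ck_on k S (\<lambda>x. L (F x))"
  using assms(3)
proof (induction k arbitrary: F)
  case 0
  then show ?case by (auto intro: bounded_linear.continuous_on[OF assms(2)])
next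
  case (Suc k)
  show ?case
    by (rule Ck_on_SucI[OF assms(1) bounded_linear.has_derivative[OF assms(2) Ck_on_Suc_deriv[OF Suc.prems]]])
      (use Suc in auto)
qed

lemma Ck_on_add:
  assumes "open S" "Ck_on k S F" "Ck_on k S G"
  shows "Ck_on k S (\<lambda>x. F x + G x)"
  using assms(2,3)
proof (induction k arbitrary: F G)
  case 0
  then show ?case by (auto intro: continuous_on_add)
next
  case (Suc k)
  show ?case
    by (rule Ck_on_SucI[OF assms(1) has_derivative_add[OF Ck_on_Suc_deriv[OF Suc.prems(1)] Ck_on_Suc_deriv[OF Suc.prems(2)]]])
      (use Suc in auto)
qed

lemma Ck_on_sum:
  assumes "open S" "\<And>i. i \<in> I \<Longrightarrow> Ck_on k S (F i)"
  shows "Ck_on k S (\<lambda>x. \<Sum>i\<in>I. F i x)"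
  using assms(2)
  by (induction I rule: infinite_finite_induct) (simp_all add: Ck_on_const Ck_on_add assms(1))

text \<open>Leibniz rule: each summand of the derivative differentiates one factor and keeps the
  other, which is also of class \<open>k\<close>, so the induction hypothesis covers both.\<close>

lemma Ck_on_bounded_bilinear:
  assumes "open S" "bounded_bilinear L" "Ck_on k S F" "Ck_on k S G"
  shows "Ck_on k S (\<lambda>x. L (F x) (G x))"
  using assms(3,4)
proof (induction k arbitrary: F G)
  case 0
  then show ?case by (auto intro: bounded_bilinear.continuous_on[OF assms(2)])
next
  case (Suc k)
  have "Ck_on k S (\<lambda>x. L (F x) (frechet_derivative G (at x) h) + L (frechet_derivative F (at x) h) (G x))" for h
    using Suc.prems by (intro Ck_on_add Suc.IH assms(1) Suc.prems[THEN Ck_on_SucD]) simp_all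
  note der = this
  show ?case
    by (rule Ck_on_SucI[OF assms(1) bounded_bilinear.FDERIV[OF assms(2) Ck_on_Suc_deriv[OF Suc.prems(1)] Ck_on_Suc_deriv[OF Suc.prems(2)]]])
      (assumption | rule der)+
qed

lemmas Ck_on_mult = Ck_on_bounded_bilinear[OF _ bounded_bilinear_mult]
lemmas Ck_on_scaleR = Ck_on_bounded_bilinear[OF _ bounded_bilinear_scaleR]

lemma Ck_on_prod:
  fixes F :: "'i \<Rightarrow> 'a::euclidean_space \<Rightarrow> real"
  assumes "open S" "\<And>i. i \<in> I \<Longrightarrow> Ck_on k S (F i)"
  shows "Ck_on k S (\<lambda>x. \<Prod>i\<in>I. F i x)"
  using assms(2)
  by (induction I rule: infinite_finite_induct) (simp_all add: Ck_on_const Ck_on_mult assms(1))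

text \<open>The derivative is a product of \<open>inverse (F x)\<close> itself and the derivative of
  \<open>F\<close>, so class \<open>k\<close> of the reciprocal yields class
  \<open>Suc k\<close>.\<close>

lemma Ck_on_inverse:
  fixes F :: "'a::euclidean_space \<Rightarrow> real"
  assumes "open S" "\<And>x. x \<in> S \<Longrightarrow> F x \<noteq> 0" "Ck_on k S F"
  shows "Ck_on k S (\<lambda>x. inverse (F x))"
  using assms(3)
proof (induction k)
  case 0
  then show ?case using assms(2) by (simp add: continuous_on_inverse)
next
  case (Suc k)
  have IH: "Ck_on k S (\<lambda>x. inverse (F x))"
    by (rule Suc.IH[OF Ck_on_SucD[OF Suc.prems]])
  have "Ck_on k S (\<lambda>x. - (inverse (F x) * frechet_derivative F (at x) h * inverse (F x)))" for h
    using Suc.prems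
    by (intro Ck_on_bounded_linear[OF assms(1) bounded_linear_minus[OF bounded_linear_ident]]
        Ck_on_mult assms(1) IH) auto
  note der = this
  show ?case
    by (rule Ck_on_SucI[OF assms(1) Deriv.has_derivative_inverse[OF assms(2) Ck_on_Suc_deriv[OF Suc.prems]]])
      (assumption | rule der)+
qed

lemma Ck_on_componentwise:
  fixes F :: "'a::euclidean_space \<Rightarrow> 'b::euclidean_space"
  assumes "open S" "\<And>b. b \<in> Basis \<Longrightarrow> Ck_on k S (\<lambda>x. F x \<bullet> b)"
  shows "Ck_on k S F"
proof -
  have "Ck_on k S (\<lambda>x. \<Sum>b\<in>Basis. (F x \<bullet> b) *\<^sub>R b)"
    using assms by (intro Ck_on_sum Ck_on_scaleR Ck_on_const) auto
  then show ?thesis by (simp add: euclidean_representation)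
qed

lemma Ck_on_vec:
  fixes F :: "'a::euclidean_space \<Rightarrow> real^'n::finite"
  assumes "open S" "\<And>i. Ck_on k S (\<lambda>x. F x $ i)"
  shows "Ck_on k S F"
  by (rule Ck_on_componentwise[OF assms(1)]) (auto simp: Basis_vec_def inner_axis assms(2))

lemma Ck_on_compose:
  fixes F :: "'a::euclidean_space \<Rightarrow> 'b::euclidean_space"
  assumes "open S" "open T" "F ` S \<subseteq> T" "Ck_on k S F" "Ck_on k T G"
  shows "Ck_on k S (\<lambda>x. G (F x))"
  using assms(4,5)
proof (induction k arbitrary: G)
  case 0
  then show ?case using assms(3) by (auto intro: continuous_on_compose2)
next
  case (Suc k)
  define F' where "F' x = frechet_derivative F (at x)" for x
  define G' where "G' x = frechet_derivative G (at x)" for x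
  have dF: "(F has_derivative F' x) (at x)" if "x \<in> S" for x
    unfolding F'_def by (rule Ck_on_Suc_deriv[OF Suc.prems(1) that])
  have dG: "(G has_derivative G' (F x)) (at (F x))" if "x \<in> S" for x
    unfolding G'_def using assms(3) that by (intro Ck_on_Suc_deriv[OF Suc.prems(2)]) auto
  show ?case
  proof (rule Ck_on_SucI[OF assms(1)])
    \<comment> \<open>Expanding \<open>F' x h\<close> in the basis leaves derivatives of
      \<open>G\<close> in fixed directions \<open>b\<close>; as functions of \<open>F x\<close> they
      fall under the induction hypothesis, which is general in \<open>G\<close>.\<close>
    show "((\<lambda>x. G (F x)) has_derivative (\<lambda>h. \<Sum>b\<in>Basis. (F' x h \<bullet> b) *\<^sub>R G' (F x) b)) (at x)"
      if "x \<in> S" for x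
    proof -
      note lin = has_derivative_linear[OF dG[OF that]]
      have "G' (F x) (F' x h) = G' (F x) (\<Sum>b\<in>Basis. (F' x h \<bullet> b) *\<^sub>R b)" for h
        by (simp only: euclidean_representation)
      then have "G' (F x) (F' x h) = (\<Sum>b\<in>Basis. (F' x h \<bullet> b) *\<^sub>R G' (F x) b)" for h
        by (simp only: linear_sum[OF lin] linear_cmul[OF lin])
      then show ?thesis using has_derivative_compose[OF dF[OF that] dG[OF that]] by simp
    qed
    have "Ck_on k S (\<lambda>x. F' x h)" for h using Suc.prems(1) by (simp add: F'_def)
    moreover have "Ck_on k S (\<lambda>x. G' (F x) b)" for b
      using Suc.prems(2) by (intro Suc.IH[OF Ck_on_SucD[OF Suc.prems(1)]]) (simp add: G'_def)
    ultimately show "Ck_on k S (\<lambda>x. \<Sum>b\<in>Basis. (F' x h \<bullet> b) *\<^sub>R G' (F x) b)" for h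
      by (intro Ck_on_sum Ck_on_scaleR assms(1)
          Ck_on_bounded_linear[OF assms(1) bounded_linear_inner_left])
  qed
qed

lemma Ck_on_det:
  fixes A :: "'a::euclidean_space \<Rightarrow> real^'n^'n::finite"
  assumes "open S" "\<And>i j. Ck_on k S (\<lambda>x. A x $ i $ j)"
  shows "Ck_on k S (\<lambda>x. det (A x))"
  unfolding det_def
  using assms by (intro Ck_on_sum Ck_on_mult Ck_on_prod Ck_on_const) auto

text \<open>The derivative of the inverse map is made explicit by Cramer's rule, which gains one order
  of differentiability at a time.\<close>

lemma Ck_on_inverse_map:
  fixes y \<psi> :: "real^'n::finite \<Rightarrow> real^'n"
  assumes "open V" "open W" "\<psi> ` W \<subseteq> V" and y: "\<And>k. Ck_on k V y"
    and d\<psi>: "\<And>u. u \<in> W \<Longrightarrow> (\<psi> has_derivative \<psi>' u) (at u)"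
    and inv: "\<And>u h. u \<in> W \<Longrightarrow> frechet_derivative y (at (\<psi> u)) (\<psi>' u h) = h"
  shows "Ck_on k W \<psi>"
proof (induction k)
  case 0
  show ?case
    by (auto intro!: continuous_at_imp_continuous_on has_derivative_continuous d\<psi>)
next
  case (Suc k)
  define D where "D x = frechet_derivative y (at x)" for x
  define J where "J x = matrix (D x)" for x
  have lin: "linear (D x)" if "x \<in> V" for x
    unfolding D_def by (rule has_derivative_linear[OF Ck_on_Suc_deriv[OF y[of "Suc 0"] that]])
  have J: "J (\<psi> u) *v \<psi>' u h = h" if "u \<in> W" for u h
    using inv[OF that] fun_cong[OF matrix_vector_mul(2)[OF lin[of "\<psi> u"]]] assms(3) that
    unfolding J_def D_def by auto
  have det: "det (J (\<psi> u)) \<noteq> 0" if "u \<in> W" for u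
  proof -
    have "surj ((*v) (J (\<psi> u)))" by (rule surjI[of _ "\<psi>' u"]) (rule J[OF that])
    then have "invertible (J (\<psi> u))"
      by (simp add: invertible_right_inverse matrix_right_invertible_surjective)
    then show ?thesis by (simp add: invertible_det_nz)
  qed
  \<comment> \<open>The entries of \<open>J\<close> are of class \<open>k\<close> on
    \<open>V\<close>; the induction hypothesis for \<open>\<psi>\<close> carries this over to
    \<open>W\<close>.\<close>
  have entry: "Ck_on k W (\<lambda>u. J (\<psi> u) $ i $ j)" for i j
  proof (rule Ck_on_compose[OF assms(2,1,3) Suc, of "\<lambda>x. J x $ i $ j"])
    have "Ck_on k V (\<lambda>x. D x (axis j 1))"
      using y[of "Suc k"] by (simp add: D_def)
    from Ck_on_bounded_linear[OF assms(1) bounded_linear_vec_nth[of i] this]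
    show "Ck_on k V (\<lambda>x. J x $ i $ j)" by (simp add: J_def matrix_def)
  qed
  define H where "H u h = (\<chi> k. det (\<chi> i j. if j = k then h $ i else J (\<psi> u) $ i $ j) * inverse (det (J (\<psi> u))))"
    for u and h :: "real^'n"
  show ?case
  proof (rule Ck_on_SucI[OF assms(2)])
    show "(\<psi> has_derivative H u) (at u)" if "u \<in> W" for u
    proof -
      have "\<psi>' u = H u"
        using iffD1[OF cramer[OF det[OF that]] J[OF that]]
        by (auto simp: H_def fun_eq_iff divide_inverse)
      with d\<psi>[OF that] show ?thesis by simp
    qed
    have cond: "Ck_on k W (\<lambda>u. if j = l then h $ i else J (\<psi> u) $ i $ j)" for i j l and h :: "real^'n"
      using entry by (cases "j = l") (auto intro: Ck_on_const[OF assms(2)])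
    show "Ck_on k W (\<lambda>u. H u h)" for h
    proof (rule Ck_on_vec[OF assms(2)])
      have "Ck_on k W (\<lambda>u. det (\<chi> i j. if j = l then h $ i else J (\<psi> u) $ i $ j))" for l
        by (rule Ck_on_det[OF assms(2)]) (simp only: vec_lambda_beta cond)
      moreover have "Ck_on k W (\<lambda>u. inverse (det (J (\<psi> u))))"
        by (rule Ck_on_inverse[OF assms(2) det Ck_on_det[OF assms(2) entry]])
      ultimately show "Ck_on k W (\<lambda>u. H u h $ l)" for l
        unfolding H_def vec_lambda_beta by (rule Ck_on_mult[OF assms(2)])
    qed
  qed
qed

section \<open>Smooth maps and the smooth inverse function theorem\<close>

lemma smooth_on_has_derivative:
  assumes "smooth_on S F" "x \<in> S"
  shows "(F has_derivative frechet_derivative F (at x)) (at x)"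
  using assms by (auto simp: smooth_on_def intro: Ck_on_Suc_deriv[of 0])

lemma smooth_on_subset: "smooth_on S F \<Longrightarrow> T \<subseteq> S \<Longrightarrow> smooth_on T F"
  by (auto simp: smooth_on_def intro: Ck_on_subset)

lemma smooth_on_const: "open S \<Longrightarrow> smooth_on S (\<lambda>x. c)"
  by (simp add: smooth_on_def Ck_on_const)

lemma smooth_on_linear:
  fixes L :: "'b::euclidean_space \<Rightarrow> 'c::euclidean_space"
  shows "open S \<Longrightarrow> linear L \<Longrightarrow> smooth_on S F \<Longrightarrow> smooth_on S (\<lambda>x. L (F x))"
  by (simp add: smooth_on_def Ck_on_bounded_linear linear_linear)

lemma smooth_on_add:
  "open S \<Longrightarrow> smooth_on S F \<Longrightarrow> smooth_on S G \<Longrightarrow> smooth_on S (\<lambda>x. F x + G x)"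
  by (simp add: smooth_on_def Ck_on_add)

lemma smooth_on_scaleR:
  "open S \<Longrightarrow> smooth_on S F \<Longrightarrow> smooth_on S G \<Longrightarrow> smooth_on S (\<lambda>x. F x *\<^sub>R G x)"
  by (simp add: smooth_on_def Ck_on_scaleR)

lemma smooth_on_mult:
  fixes F G :: "'a::euclidean_space \<Rightarrow> real"
  shows "open S \<Longrightarrow> smooth_on S F \<Longrightarrow> smooth_on S G \<Longrightarrow> smooth_on S (\<lambda>x. F x * G x)"
  by (simp add: smooth_on_def Ck_on_mult)

lemma smooth_on_inverse:
  fixes F :: "'a::euclidean_space \<Rightarrow> real"
  shows "open S \<Longrightarrow> (\<And>x. x \<in> S \<Longrightarrow> F x \<noteq> 0) \<Longrightarrow> smooth_on S F \<Longrightarrow> smooth_on S (\<lambda>x. inverse (F x))"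
  by (simp add: smooth_on_def Ck_on_inverse)

lemma smooth_on_cong:
  "open S \<Longrightarrow> (\<And>x. x \<in> S \<Longrightarrow> F x = G x) \<Longrightarrow> smooth_on S F \<Longrightarrow> smooth_on S G"
  using Ck_on_cong[of S F G] by (auto simp: smooth_on_def)

lemma smooth_on_compose:
  fixes F :: "'a::euclidean_space \<Rightarrow> 'b::euclidean_space"
  assumes "open S" "open T" "F ` S \<subseteq> T" "smooth_on S F" "smooth_on T G"
  shows "smooth_on S (\<lambda>x. G (F x))"
  using assms(4,5) Ck_on_compose[OF assms(1-3)] by (auto simp: smooth_on_def)

lemma smooth_on_imp_continuous_on: "smooth_on S F \<Longrightarrow> continuous_on S F"
  unfolding smooth_on_def using Ck_on.simps(1) by blast

text \<open>The inverse function theorem for continuously differentiable maps supplies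
  \<open>\<psi>\<close>, and \<open>Ck_on_inverse_map\<close> raises it to a smooth map.\<close>

lemma smooth_inverse_function:
  fixes y :: "real^'n::finite \<Rightarrow> real^'n"
  assumes "open V" "v0 \<in> V" and y: "smooth_on V y"
    and "(y has_derivative (\<lambda>h. h)) (at v0)"
  obtains V' W \<psi> where "open V'" "v0 \<in> V'" "V' \<subseteq> V" "open W" "homeomorphism V' W y \<psi>"
    "smooth_on W \<psi>" "\<And>v. v \<in> V' \<Longrightarrow> inj (frechet_derivative y (at v))"
proof -
  define D where "D x = frechet_derivative y (at x)" for x
  have dy: "(y has_derivative D x) (at x)" if "x \<in> V" for x
    unfolding D_def by (rule smooth_on_has_derivative[OF y that])
  \<comment> \<open>The inverse function theorem wants the derivative as a continuous map into
    bounded linear functions. In finite dimension continuity in each fixed direction is enough, and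
    that is contained in class 1.\<close>
  define y' where "y' x = Blinfun (D x)" for x
  have y': "blinfun_apply (y' x) = D x" if "x \<in> V" for x
    unfolding y'_def by (rule bounded_linear_Blinfun_apply[OF has_derivative_bounded_linear[OF dy[OF that]]])
  have "continuous_on V (\<lambda>x. D x h)" for h
    using y[unfolded smooth_on_def, THEN spec, of "Suc 0"] by (simp add: D_def)
  then have "continuous_on V (\<lambda>x. y' x h)" for h
    by (subst continuous_on_cong[OF refl]) (auto simp: y')
  then have cont: "continuous_on V y'" by (intro continuous_on_blinfun_componentwise)
  have "D v0 = (\<lambda>h. h)" using frechet_derivative_at[OF assms(4)] by (simp add: D_def)
  then have id: "id_blinfun o\<^sub>L y' v0 = id_blinfun"
    by (intro blinfun_eqI) (simp add: y' assms(2))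
  obtain V' W \<psi> \<psi>' where V': "open V'" "V' \<subseteq> V" "v0 \<in> V'" "open W" "homeomorphism V' W y \<psi>"
    and d\<psi>: "\<And>u. u \<in> W \<Longrightarrow> (\<psi> has_derivative (\<psi>' u)) (at u)"
    and inv: "\<And>u. u \<in> W \<Longrightarrow> \<psi>' u = inv (blinfun_apply (y' (\<psi> u)))"
      "\<And>u. u \<in> W \<Longrightarrow> bij (blinfun_apply (y' (\<psi> u)))"
    using inverse_function_theorem[OF \<open>open V\<close> _ cont \<open>v0 \<in> V\<close> id, of y] dy y' by metis
  have \<psi>: "\<psi> u \<in> V'" if "u \<in> W" for u using V'(5) that by (auto simp: homeomorphism_def)
  have DD: "D (\<psi> u) (\<psi>' u h) = h" if "u \<in> W" for u h
    using inv[OF that] y'[of "\<psi> u"] \<psi>[OF that] V'(2) by (auto simp: bij_is_surj surj_f_inv_f)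
  have "smooth_on W \<psi>"
    unfolding smooth_on_def
    using Ck_on_inverse_map[OF \<open>open V\<close> \<open>open W\<close> _ _ d\<psi>, of y] \<psi> V'(2) y DD
    by (auto simp: smooth_on_def D_def)
  moreover have "inj (D v)" if "v \<in> V'" for v
  proof -
    have "y v \<in> W" "\<psi> (y v) = v" using V'(5) that by (auto simp: homeomorphism_def)
    then show ?thesis using inv(2)[of "y v"] y'[of v] that V'(2) by (auto simp: bij_is_inj)
  qed
  ultimately show ?thesis using that V' unfolding D_def by blast
qed

section \<open>Conservation laws in terms of derivatives\<close>

lemma linear_expand_axis:
  fixes D :: "real^'n::finite \<Rightarrow> real"
  assumes "linear D"
  shows "D y = (\<Sum>k\<in>UNIV. D (axis k 1) * y $ k)"
proof -
  have "D y = D (\<Sum>k\<in>UNIV. y $ k *s axis k 1)" by (simp add: basis_expansion)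
  then show ?thesis
    by (simp add: linear_sum[OF assms] scalar_mult_eq_scaleR linear_cmul[OF assms] mult.commute)
qed

text \<open>The sum is \<open>B'\<close> applied to \<open>f' (axis i 1)\<close>, and both sides are
  linear in the direction, so the axes decide. The coordinate-free form combines directly with the
  chain rule under a change of parameter.\<close>

lemma conservation_law_iff:
  fixes f :: "real^'n::finite \<Rightarrow> real^'n"
  assumes hB: "(B has_derivative B') (at u)" and hA: "(A has_derivative A') (at u)"
    and hf: "(f has_derivative f') (at u)"
  shows "(\<forall>i. pderiv_at i A u = (\<Sum>k\<in>UNIV. pderiv_at k B u * pderiv_at i (\<lambda>w. f w $ k) u))
    \<longleftrightarrow> (\<forall>h. A' h = B' (f' h))"
proof -
  note lin = assms[THEN has_derivative_linear]
  have "((\<lambda>w. f w $ k) has_derivative (\<lambda>h. f' h $ k)) (at u)" for k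
    by (rule bounded_linear.has_derivative[OF bounded_linear_vec_nth hf])
  then have fk: "pderiv_at i (\<lambda>w. f w $ k) u = f' (axis i 1) $ k" for i k
    unfolding pderiv_at_def by (metis frechet_derivative_at)
  have "pderiv_at k B u = B' (axis k 1)" "pderiv_at k A u = A' (axis k 1)" for k
    using frechet_derivative_at[OF hB] frechet_derivative_at[OF hA] by (simp_all add: pderiv_at_def)
  then have "(\<forall>i. pderiv_at i A u = (\<Sum>k\<in>UNIV. pderiv_at k B u * pderiv_at i (\<lambda>w. f w $ k) u))
    \<longleftrightarrow> (\<forall>i. A' (axis i 1) = B' (f' (axis i 1)))"
    by (simp add: fk linear_expand_axis[OF lin(1), symmetric])
  also have "\<dots> \<longleftrightarrow> (\<forall>h. A' h = B' (f' h))"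
  proof (intro iffI allI)
    fix h assume *: "\<forall>i. A' (axis i 1) = B' (f' (axis i 1))"
    show "A' h = B' (f' h)"
      unfolding linear_expand_axis[OF lin(2), of h]
        linear_expand_axis[OF linear_compose[OF lin(3,1)], of h, unfolded o_def]
      by (simp only: * )
  qed simp
  finally show ?thesis .
qed

section \<open>Tangent spaces along a generator\<close>

lemma span_pair: "x \<in> span {a, b} \<longleftrightarrow> (\<exists>c d. x = c *\<^sub>R a + d *\<^sub>R b)"
  unfolding span_breakdown_eq[of x a] span_singleton image_iff
  by (simp add: algebra_simps)

text \<open>Product rule. Varying the coefficients \<open>s\<close> and \<open>t\<close> contributes
  the generator itself, so every tangent space contains the whole line.\<close>

lemma tangent_space_eq_range:
  assumes hp: "(p has_derivative p') (at v)" and hq: "(q has_derivative q') (at v)"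
  shows "tangent_space p q v s t = range (\<lambda>(h, a, b). s *\<^sub>R p' h + t *\<^sub>R q' h + a *\<^sub>R p v + b *\<^sub>R q v)"
proof -
  have summand: "((\<lambda>z. \<pi> z *\<^sub>R F (fst z)) has_derivative (\<lambda>z. \<pi> (v, s, t) *\<^sub>R F' (fst z) + \<pi> z *\<^sub>R F v)) (at (v, s, t))"
    if F: "(F has_derivative F') (at v)" and \<pi>: "bounded_linear \<pi>"
    for F :: "real^'a \<Rightarrow> 'a hcoords" and F' and \<pi> :: "(real^'a) \<times> real \<times> real \<Rightarrow> real"
  proof -
    have "((\<lambda>z. F (fst z)) has_derivative (\<lambda>z. F' (fst z))) (at (v, s, t))"
      by (rule has_derivative_compose[OF has_derivative_fst[OF has_derivative_ident]]) (simp add: F)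
    from has_derivative_scaleR[OF bounded_linear_imp_has_derivative[OF \<pi>] this] show ?thesis by simp
  qed
  have lin: "bounded_linear (\<lambda>z::(real^'a) \<times> real \<times> real. fst (snd z))"
    "bounded_linear (\<lambda>z::(real^'a) \<times> real \<times> real. snd (snd z))"
    by (auto intro: bounded_linear_compose[OF bounded_linear_fst] bounded_linear_compose[OF bounded_linear_snd]
        bounded_linear_snd)
  have "ruled_param p q = (\<lambda>z. fst (snd z) *\<^sub>R p (fst z) + snd (snd z) *\<^sub>R q (fst z))"
    by (auto simp: ruled_param_def)
  then have "(ruled_param p q has_derivative
      (\<lambda>(h, a, b). s *\<^sub>R p' h + t *\<^sub>R q' h + a *\<^sub>R p v + b *\<^sub>R q v)) (at (v, s, t))"
    using has_derivative_add[OF summand[OF hp lin(1)] summand[OF hq lin(2)]]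
    by (simp add: case_prod_beta' algebra_simps)
  from frechet_derivative_at[OF this] show ?thesis by (simp add: tangent_space_def)
qed

lemma mem_tangent_space:
  assumes "(p has_derivative p') (at v)" "(q has_derivative q') (at v)"
  shows "x \<in> tangent_space p q v s t \<longleftrightarrow>
    (\<exists>h a b. x = s *\<^sub>R p' h + t *\<^sub>R q' h + a *\<^sub>R p v + b *\<^sub>R q v)"
  unfolding tangent_space_eq_range[OF assms] by (simp add: image_iff)

section \<open>Stability at a single generator and its invariance\<close>

definition stable_at ::
  "(real^'n::finite \<Rightarrow> 'n hcoords) \<Rightarrow> (real^'n \<Rightarrow> 'n hcoords) \<Rightarrow> real^'n \<Rightarrow> bool"
where
  "stable_at p q v \<longleftrightarrow>
     (\<forall>s t s' t'. smooth_point p q v s t \<longrightarrow> smooth_point p q v s' t' \<longrightarrow>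
        tangent_space p q v s t = tangent_space p q v s' t')"

lemma stable_tangent_spaces_iff: "stable_tangent_spaces V p q \<longleftrightarrow> (\<forall>v\<in>V. stable_at p q v)"
  by (auto simp: stable_tangent_spaces_def stable_at_def)

text \<open>An injective linear map takes tangent spaces to their images and preserves dimension,
  hence also smooth points: stability is projectively invariant.\<close>

lemma stable_at_linear:
  assumes "p differentiable (at v)" "q differentiable (at v)" and k: "linear k" "inj k"
    and st: "stable_at p q v"
  shows "stable_at (\<lambda>w. k (p w)) (\<lambda>w. k (q w)) v"
proof -
  obtain p' q' where d: "(p has_derivative p') (at v)" "(q has_derivative q') (at v)"
    using assms(1,2) by (auto simp: differentiable_def)
  have kd: "((\<lambda>w. k (F w)) has_derivative (\<lambda>h. k (F' h))) (at v)"
    if "(F has_derivative F') (at v)" for F F'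
    by (rule bounded_linear.has_derivative[OF linear_linear[THEN iffD2, OF k(1)] that])
  have T: "tangent_space (\<lambda>w. k (p w)) (\<lambda>w. k (q w)) v s t = k ` tangent_space p q v s t" for s t
  proof -
    have "(\<lambda>(h, a, b). s *\<^sub>R k (p' h) + t *\<^sub>R k (q' h) + a *\<^sub>R k (p v) + b *\<^sub>R k (q v))
        = (\<lambda>z. k ((\<lambda>(h, a, b). s *\<^sub>R p' h + t *\<^sub>R q' h + a *\<^sub>R p v + b *\<^sub>R q v) z))"
      by (simp add: fun_eq_iff linear_add[OF k(1)] linear_cmul[OF k(1)])
    then show ?thesis
      unfolding tangent_space_eq_range[OF kd[OF d(1)] kd[OF d(2)]] tangent_space_eq_range[OF d]
      by (simp only: image_image)
  qed
  have "dim (k ` S) = dim S" for S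
    by (rule dim_image_eq[OF k(1)]) (use k(2) in \<open>auto intro: inj_on_subset\<close>)
  then have "smooth_point (\<lambda>w. k (p w)) (\<lambda>w. k (q w)) v s t \<longleftrightarrow> smooth_point p q v s t" for s t
    by (simp add: smooth_point_def T)
  with st show ?thesis unfolding stable_at_def T by metis
qed

text \<open>Differentiating the coefficients only adds vectors of the generator, which lie in the
  tangent space anyway. So the tangent space at (s, t) in the new frame is the old one at the
  transformed homogeneous coordinates.\<close>

lemma stable_at_frame_change:
  fixes p q P Q :: "real^'n::finite \<Rightarrow> 'n hcoords" and \<alpha> \<beta> \<gamma> \<delta> :: "real^'n \<Rightarrow> real"
  assumes S: "open S" "v \<in> S"
    and diff: "p differentiable (at v)" "q differentiable (at v)" "\<alpha> differentiable (at v)"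
      "\<beta> differentiable (at v)" "\<gamma> differentiable (at v)" "\<delta> differentiable (at v)"
    and P: "\<And>w. w \<in> S \<Longrightarrow> P w = \<alpha> w *\<^sub>R p w + \<beta> w *\<^sub>R q w"
    and Q: "\<And>w. w \<in> S \<Longrightarrow> Q w = \<gamma> w *\<^sub>R p w + \<delta> w *\<^sub>R q w"
    and det: "\<alpha> v * \<delta> v - \<beta> v * \<gamma> v \<noteq> 0"
    and st: "stable_at p q v"
  shows "stable_at P Q v"
proof -
  obtain p' q' \<alpha>' \<beta>' \<gamma>' \<delta>' where d: "(p has_derivative p') (at v)" "(q has_derivative q') (at v)"
    "(\<alpha> has_derivative \<alpha>') (at v)" "(\<beta> has_derivative \<beta>') (at v)"
    "(\<gamma> has_derivative \<gamma>') (at v)" "(\<delta> has_derivative \<delta>') (at v)"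
    using diff by (auto simp: differentiable_def)
  have comb: "(F has_derivative (\<lambda>h. (a v *\<^sub>R p' h + a' h *\<^sub>R p v) + (b v *\<^sub>R q' h + b' h *\<^sub>R q v))) (at v)"
    if F: "\<And>w. w \<in> S \<Longrightarrow> F w = a w *\<^sub>R p w + b w *\<^sub>R q w"
      and "(a has_derivative a') (at v)" "(b has_derivative b') (at v)" for F a b a' b'
    by (rule has_derivative_transform_within_open[OF has_derivative_add[OF
            has_derivative_scaleR[OF that(2) d(1)] has_derivative_scaleR[OF that(3) d(2)]] S])
      (simp add: F)
  note dP = comb[OF P d(3,4)] and dQ = comb[OF Q d(5,6)]
  have T: "tangent_space P Q v s t = tangent_space p q v (s * \<alpha> v + t * \<gamma> v) (s * \<beta> v + t * \<delta> v)"
    (is "_ = tangent_space p q v ?s ?t") for s t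
  proof -
    have eq: "s *\<^sub>R ((\<alpha> v *\<^sub>R p' h + \<alpha>' h *\<^sub>R p v) + (\<beta> v *\<^sub>R q' h + \<beta>' h *\<^sub>R q v))
      + t *\<^sub>R ((\<gamma> v *\<^sub>R p' h + \<gamma>' h *\<^sub>R p v) + (\<delta> v *\<^sub>R q' h + \<delta>' h *\<^sub>R q v)) + a *\<^sub>R P v + b *\<^sub>R Q v
      = ?s *\<^sub>R p' h + ?t *\<^sub>R q' h + (s * \<alpha>' h + t * \<gamma>' h + a * \<alpha> v + b * \<gamma> v) *\<^sub>R p v
        + (s * \<beta>' h + t * \<delta>' h + a * \<beta> v + b * \<delta> v) *\<^sub>R q v" for h a b
      by (simp add: P[OF S(2)] Q[OF S(2)] algebra_simps)
    \<comment> \<open>Cramer's rule for the frame change: suitable \<open>a\<close> and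
      \<open>b\<close> produce any prescribed component along the generator.\<close>
    have solve: "\<exists>a b. c = e + a * \<alpha> v + b * \<gamma> v \<and> d = f + a * \<beta> v + b * \<delta> v" for c d e f
    proof (intro exI conjI)
      let ?\<Delta> = "\<alpha> v * \<delta> v - \<beta> v * \<gamma> v"
      let ?a = "((c - e) * \<delta> v - (d - f) * \<gamma> v) / ?\<Delta>"
      let ?b = "((d - f) * \<alpha> v - (c - e) * \<beta> v) / ?\<Delta>"
      have "?a * \<alpha> v + ?b * \<gamma> v = ((c - e) * ?\<Delta>) / ?\<Delta>"
        unfolding times_divide_eq_left add_divide_distrib[symmetric] by (simp add: algebra_simps)
      then show "c = e + ?a * \<alpha> v + ?b * \<gamma> v" using det by simp
      have "?a * \<beta> v + ?b * \<delta> v = ((d - f) * ?\<Delta>) / ?\<Delta>"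
        unfolding times_divide_eq_left add_divide_distrib[symmetric] by (simp add: algebra_simps)
      then show "d = f + ?a * \<beta> v + ?b * \<delta> v" using det by simp
    qed
    show ?thesis
    proof (intro set_eqI iffI)
      fix x assume "x \<in> tangent_space P Q v s t"
      then obtain h a b where "x = s *\<^sub>R ((\<alpha> v *\<^sub>R p' h + \<alpha>' h *\<^sub>R p v) + (\<beta> v *\<^sub>R q' h + \<beta>' h *\<^sub>R q v))
        + t *\<^sub>R ((\<gamma> v *\<^sub>R p' h + \<gamma>' h *\<^sub>R p v) + (\<delta> v *\<^sub>R q' h + \<delta>' h *\<^sub>R q v)) + a *\<^sub>R P v + b *\<^sub>R Q v"
        using mem_tangent_space[OF dP dQ] by blast
      then show "x \<in> tangent_space p q v ?s ?t"
        unfolding eq mem_tangent_space[OF d(1,2)] by blast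
    next
      fix x assume "x \<in> tangent_space p q v ?s ?t"
      then obtain h c d where "x = ?s *\<^sub>R p' h + ?t *\<^sub>R q' h + c *\<^sub>R p v + d *\<^sub>R q v"
        unfolding mem_tangent_space[OF d(1,2)] by blast
      moreover obtain a b where "c = s * \<alpha>' h + t * \<gamma>' h + a * \<alpha> v + b * \<gamma> v"
        "d = s * \<beta>' h + t * \<delta>' h + a * \<beta> v + b * \<delta> v"
        using solve by blast
      ultimately have "x = s *\<^sub>R ((\<alpha> v *\<^sub>R p' h + \<alpha>' h *\<^sub>R p v) + (\<beta> v *\<^sub>R q' h + \<beta>' h *\<^sub>R q v))
        + t *\<^sub>R ((\<gamma> v *\<^sub>R p' h + \<gamma>' h *\<^sub>R p v) + (\<delta> v *\<^sub>R q' h + \<delta>' h *\<^sub>R q v)) + a *\<^sub>R P v + b *\<^sub>R Q v"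
        unfolding eq by simp
      then show "x \<in> tangent_space P Q v s t"
        using mem_tangent_space[OF dP dQ] by blast
    qed
  qed
  \<comment> \<open>Invertibility of the frame change keeps homogeneous coordinates away from (0,
    0), as \<open>smooth_point\<close> demands.\<close>
  have nz: "s = 0 \<and> t = 0" if "s * \<alpha> v + t * \<gamma> v = 0" "s * \<beta> v + t * \<delta> v = 0" for s t
  proof -
    have "s * (\<alpha> v * \<delta> v - \<beta> v * \<gamma> v) = (s * \<alpha> v + t * \<gamma> v) * \<delta> v - (s * \<beta> v + t * \<delta> v) * \<gamma> v"
      "t * (\<alpha> v * \<delta> v - \<beta> v * \<gamma> v) = (s * \<beta> v + t * \<delta> v) * \<alpha> v - (s * \<alpha> v + t * \<gamma> v) * \<beta> v"
      by (simp_all add: algebra_simps)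
    then have "s * (\<alpha> v * \<delta> v - \<beta> v * \<gamma> v) = 0" "t * (\<alpha> v * \<delta> v - \<beta> v * \<gamma> v) = 0"
      unfolding that by simp_all
    then show ?thesis using det by simp
  qed
  have "smooth_point p q v (s * \<alpha> v + t * \<gamma> v) (s * \<beta> v + t * \<delta> v)"
    if "smooth_point P Q v s t" for s t
    using that nz[of s t] by (auto simp: smooth_point_def T)
  with st show ?thesis unfolding stable_at_def T by metis
qed

section \<open>Smooth points as points with injective tangent map\<close>

text \<open>If a nonzero \<open>z\<close> is sent to 0, removing the component along
  \<open>z\<close> shows that the hyperplane orthogonal to \<open>z\<close> already has the full
  image, whose dimension is then too small.\<close>

lemma dim_range_eq_iff_inj:
  fixes L :: "'a::euclidean_space \<Rightarrow> 'b::euclidean_space"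
  assumes L: "linear L"
  shows "dim (range L) = DIM('a) \<longleftrightarrow> inj L"
proof
  assume dim: "dim (range L) = DIM('a)"
  show "inj L" unfolding linear_injective_0[OF L]
  proof (intro allI impI, rule ccontr)
    fix z assume z: "L z = 0" "z \<noteq> 0"
    have "range L \<subseteq> L ` {x. z \<bullet> x = 0}"
    proof (intro image_subsetI image_eqI)
      fix x
      show "L x = L (x - (z \<bullet> x / (z \<bullet> z)) *\<^sub>R z)"
        by (simp add: linear_diff[OF L] linear_cmul[OF L] z(1))
      show "x - (z \<bullet> x / (z \<bullet> z)) *\<^sub>R z \<in> {x. z \<bullet> x = 0}"
        using z(2) by (simp add: inner_diff_right)
    qed
    then have "dim (range L) \<le> dim (L ` {x. z \<bullet> x = 0})" by (rule dim_subset)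
    also have "\<dots> \<le> dim {x. z \<bullet> x = 0}" by (rule dim_image_le[OF L])
    also have "\<dots> = DIM('a) - 1" using z(2) by (rule dim_hyperplane)
    finally show False using dim DIM_positive[where 'a='a] by linarith
  qed
next
  assume "inj L"
  then show "dim (range L) = DIM('a)" using dim_image_eq[OF L, of UNIV] by simp
qed

lemma linear_tangent_map:
  assumes "linear p'" "linear q'"
  shows "linear (\<lambda>(h, a, b). s *\<^sub>R p' h + t *\<^sub>R q' h + a *\<^sub>R x + b *\<^sub>R y)"
  by (rule linearI)
    (auto simp: linear_add[OF assms(1)] linear_add[OF assms(2)] linear_cmul[OF assms(1)]
      linear_cmul[OF assms(2)] scaleR_add_right scaleR_add_left mult.commute)

lemma subspace_tangent_space:
  assumes "(p has_derivative p') (at v)" "(q has_derivative q') (at v)"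
  shows "subspace (tangent_space p q v s t)"
  unfolding tangent_space_eq_range[OF assms]
  by (rule linear_subspace_image[OF linear_tangent_map[OF assms[THEN has_derivative_linear]] subspace_UNIV])

text \<open>The tangent map starts from a space of dimension n + 2, so rank n + 2 amounts to a
  trivial kernel.\<close>

lemma smooth_point_iff:
  fixes p q :: "real^'n::finite \<Rightarrow> 'n hcoords"
  assumes "(p has_derivative p') (at v)" "(q has_derivative q') (at v)"
  shows "smooth_point p q v s t \<longleftrightarrow> (s, t) \<noteq> (0, 0) \<and>
    (\<forall>h a b. s *\<^sub>R p' h + t *\<^sub>R q' h + a *\<^sub>R p v + b *\<^sub>R q v = 0 \<longrightarrow> h = 0 \<and> a = 0 \<and> b = 0)"
proof -
  define L where "L = (\<lambda>(h, a, b). s *\<^sub>R p' h + t *\<^sub>R q' h + a *\<^sub>R p v + b *\<^sub>R q v)"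
  have L: "linear L" unfolding L_def
    by (rule linear_tangent_map[OF assms[THEN has_derivative_linear]])
  have "dim (range L) = CARD('n) + 2 \<longleftrightarrow> (\<forall>z. L z = 0 \<longrightarrow> z = 0)"
    using dim_range_eq_iff_inj[OF L] linear_injective_0[OF L] by simp
  then show ?thesis
    unfolding smooth_point_def tangent_space_eq_range[OF assms] L_def[symmetric]
    by (simp add: L_def zero_prod_def)
qed

section \<open>Normal frames\<close>

text \<open>A line on which Y^0 and Y^(n+3) are independent contains exactly one vector with (Y^0,
  Y^(n+3)) = (1, 0) and one, the \<open>e3_frame\<close>, with (0, 1). On the line of a system they
  carry (u, B, N) and (f, A, M).\<close>

definition e0_frame :: "('a \<Rightarrow> real^'n::finite) \<Rightarrow> ('a \<Rightarrow> real) \<Rightarrow> ('a \<Rightarrow> real) \<Rightarrow> 'a \<Rightarrow> 'n hcoords" where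
  "e0_frame y b n = (\<lambda>w. (1, y w, b w, n w, 0))"

definition e3_frame :: "('a \<Rightarrow> real^'n::finite) \<Rightarrow> ('a \<Rightarrow> real) \<Rightarrow> ('a \<Rightarrow> real) \<Rightarrow> 'a \<Rightarrow> 'n hcoords" where
  "e3_frame z a m = (\<lambda>w. (0, z w, a w, m w, 1))"

lemma system_line_eq_span:
  "system_line f B A N M u = span {e0_frame (\<lambda>u. u) B N u, e3_frame f A M u}"
  by (auto simp: system_line_def span_pair e0_frame_def e3_frame_def vec_eq_iff algebra_simps)

lemma has_derivative_frames:
  assumes "(y has_derivative y') (at v)" "(b has_derivative b') (at v)" "(n has_derivative n') (at v)"
  shows "(e0_frame y b n has_derivative (\<lambda>h. (0, y' h, b' h, n' h, 0))) (at v)"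
    and "(e3_frame y b n has_derivative (\<lambda>h. (0, y' h, b' h, n' h, 0))) (at v)"
  using assms by (auto simp: e0_frame_def e3_frame_def intro!: has_derivative_Pair has_derivative_const)

text \<open>The relations put every tangent space of the line into one space \<open>E\<close> of
  dimension at most n + 2; at a smooth point the dimensions force equality. For a system,
  \<open>\<beta>\<close> and \<open>\<nu>\<close> are the derivatives of \<open>B\<close> and
  \<open>N\<close>.\<close>

lemma stable_at_normal_frame:
  fixes y z :: "real^'n::finite \<Rightarrow> real^'n"
  assumes P: "(y has_derivative y') (at v)" "(b has_derivative b') (at v)" "(n has_derivative n') (at v)"
    and Q: "(z has_derivative z') (at v)" "(a has_derivative a') (at v)" "(m has_derivative m') (at v)"
    and lin: "linear \<beta>" "linear \<nu>"
    and rel: "\<And>h. b' h = \<beta> (y' h)" "\<And>h. n' h = \<nu> (y' h)" "\<And>h. a' h = \<beta> (z' h)" "\<And>h. m' h = \<nu> (z' h)"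
  shows "stable_at (e0_frame y b n) (e3_frame z a m) v"
proof -
  note d = has_derivative_frames(1)[OF P] has_derivative_frames(2)[OF Q]
  \<comment> \<open>\<open>E\<close> imitates the formula for a tangent space, with coefficients 1
    and 0, so that \<open>linear_tangent_map\<close> makes it a linear image of an (n +
    2)-dimensional space.\<close>
  define E where "E = range (\<lambda>(k, c, d). 1 *\<^sub>R (0, k, \<beta> k, \<nu> k, 0) + 0 *\<^sub>R (0, k, \<beta> k, \<nu> k, 0)
    + c *\<^sub>R e0_frame y b n v + d *\<^sub>R e3_frame z a m v)"
  have "linear (\<lambda>k. (0, k, \<beta> k, \<nu> k, 0) :: 'n hcoords)"
    by (rule linearI) (auto simp: linear_add[OF lin(1)] linear_add[OF lin(2)]
        linear_cmul[OF lin(1)] linear_cmul[OF lin(2)])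
  note L = linear_tangent_map[OF this this]
  have "subspace E"
    unfolding E_def by (rule linear_subspace_image[OF L subspace_UNIV])
  moreover have "dim E \<le> dim (UNIV :: ((real^'n) \<times> real \<times> real) set)"
    unfolding E_def by (rule dim_image_le[OF L])
  ultimately have E: "subspace E" "dim E \<le> CARD('n) + 2" by simp_all
  have "tangent_space (e0_frame y b n) (e3_frame z a m) v s t = E"
    if "smooth_point (e0_frame y b n) (e3_frame z a m) v s t" for s t
  proof (rule subspace_dim_equal[OF subspace_tangent_space[OF d] E(1)])
    show "tangent_space (e0_frame y b n) (e3_frame z a m) v s t \<subseteq> E"
    proof
      fix x assume "x \<in> tangent_space (e0_frame y b n) (e3_frame z a m) v s t"
      then obtain h c d where "x = s *\<^sub>R (0, y' h, b' h, n' h, 0) + t *\<^sub>R (0, z' h, a' h, m' h, 0)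
          + c *\<^sub>R e0_frame y b n v + d *\<^sub>R e3_frame z a m v"
        unfolding mem_tangent_space[OF d] by blast
      \<comment> \<open>By \<open>rel\<close> the derivative part of \<open>x\<close> is the vector
        of \<open>E\<close> with parameter \<open>s y' h + t z' h\<close>.\<close>
      then have "x = (\<lambda>(k, c, d). 1 *\<^sub>R (0, k, \<beta> k, \<nu> k, 0) + 0 *\<^sub>R (0, k, \<beta> k, \<nu> k, 0)
        + c *\<^sub>R e0_frame y b n v + d *\<^sub>R e3_frame z a m v) (s *\<^sub>R y' h + t *\<^sub>R z' h, c, d)"
        by (simp add: rel linear_add[OF lin(1)] linear_add[OF lin(2)]
            linear_cmul[OF lin(1)] linear_cmul[OF lin(2)])
      then show "x \<in> E" unfolding E_def by (rule image_eqI) simp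
    qed
    show "dim E \<le> dim (tangent_space (e0_frame y b n) (e3_frame z a m) v s t)"
      using that E(2) by (simp add: smooth_point_def)
  qed
  then show ?thesis unfolding stable_at_def by metis
qed

text \<open>Stability is tested at (1, 0) and (1, \<epsilon>): the derivative part at the second
  point must occur at the first, and subtracting isolates \<open>z'\<close>, \<open>a'\<close>,
  \<open>m'\<close> with one common direction \<open>k\<close>.\<close>

lemma normal_frame_stable_at:
  fixes y z :: "real^'n::finite \<Rightarrow> real^'n"
  assumes P: "(y has_derivative y') (at v)" "(b has_derivative b') (at v)" "(n has_derivative n') (at v)"
    and Q: "(z has_derivative z') (at v)" "(a has_derivative a') (at v)" "(m has_derivative m') (at v)"
    and inj: "inj y'" and st: "stable_at (e0_frame y b n) (e3_frame z a m) v"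
  shows "\<exists>k. z' h = y' k \<and> a' h = b' k \<and> m' h = n' k"
proof -
  note d = has_derivative_frames(1)[OF P] has_derivative_frames(2)[OF Q]
  note lin = P[THEN has_derivative_linear] Q[THEN has_derivative_linear]
  obtain c where c: "c > 0" "\<And>h. c * norm h \<le> norm (y' h)"
    by (rule linear_inj_bounded_below_pos[OF lin(1) inj]) (rule that)
  obtain C where C: "C > 0" "\<And>h. norm (z' h) \<le> C * norm h"
    by (rule linear_bounded_pos[OF lin(4)]) (rule that)
  \<comment> \<open>With this choice \<open>\<epsilon> z'\<close> has at most half the lower bound
    of \<open>y'\<close>, so \<open>y' + \<epsilon> z'\<close> stays injective and (1, \<epsilon>)
    is a smooth point.\<close>
  define \<epsilon> where "\<epsilon> = c / (2 * C)"
  have \<epsilon>: "\<epsilon> > 0" using c(1) C(1) by (simp add: \<epsilon>_def)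
  have inj\<epsilon>: "h = 0" if "y' h + \<epsilon> *\<^sub>R z' h = 0" for h
  proof -
    have "y' h = - (\<epsilon> *\<^sub>R z' h)" using that by (simp add: eq_neg_iff_add_eq_0)
    then have "norm (y' h) = \<epsilon> * norm (z' h)" using \<epsilon> by simp
    also have "\<dots> \<le> \<epsilon> * (C * norm h)" using C(2) \<epsilon> by simp
    also have "\<dots> = c / 2 * norm h" using C(1) by (simp add: \<epsilon>_def)
    finally have "c * norm h \<le> c / 2 * norm h" using c(2)[of h] by linarith
    then show "h = 0" using c(1) by simp
  qed
  have inj0: "h = 0" if "y' h = 0" for h
    using iffD1[OF linear_injective_0[OF lin(1)] inj] that by blast
  have sp: "smooth_point (e0_frame y b n) (e3_frame z a m) v 1 \<epsilon>"
    "smooth_point (e0_frame y b n) (e3_frame z a m) v 1 0"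
    unfolding smooth_point_iff[OF d]
    by (auto simp: e0_frame_def e3_frame_def zero_prod_def dest: inj\<epsilon> inj0)
  have T: "tangent_space (e0_frame y b n) (e3_frame z a m) v 1 \<epsilon>
    = tangent_space (e0_frame y b n) (e3_frame z a m) v 1 0"
    by (rule st[unfolded stable_at_def, rule_format, OF sp])
  have "1 *\<^sub>R (0, y' h, b' h, n' h, 0) + \<epsilon> *\<^sub>R (0, z' h, a' h, m' h, 0)
    + 0 *\<^sub>R e0_frame y b n v + 0 *\<^sub>R e3_frame z a m v
    \<in> tangent_space (e0_frame y b n) (e3_frame z a m) v 1 \<epsilon>"
    unfolding mem_tangent_space[OF d] by (intro exI, rule refl)
  then obtain k c d where "1 *\<^sub>R (0, y' h, b' h, n' h, 0) + \<epsilon> *\<^sub>R (0, z' h, a' h, m' h, 0)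
    + 0 *\<^sub>R e0_frame y b n v + 0 *\<^sub>R e3_frame z a m v
    = 1 *\<^sub>R (0, y' k, b' k, n' k, 0) + 0 *\<^sub>R (0, z' k, a' k, m' k, 0)
    + c *\<^sub>R e0_frame y b n v + d *\<^sub>R e3_frame z a m v"
    unfolding T mem_tangent_space[OF d] by (elim exE)
  \<comment> \<open>The first and last coordinates give \<open>c = 0\<close> and
    \<open>d = 0\<close>, so only derivative parts remain.\<close>
  then have eq: "y' h + \<epsilon> *\<^sub>R z' h = y' k" "b' h + \<epsilon> * a' h = b' k" "n' h + \<epsilon> * m' h = n' k"
    by (simp_all add: e0_frame_def e3_frame_def)
  let ?k = "(1 / \<epsilon>) *\<^sub>R (k - h)"
  have "y' ?k = (1 / \<epsilon>) *\<^sub>R (\<epsilon> *\<^sub>R z' h)" "b' ?k = (1 / \<epsilon>) *\<^sub>R (\<epsilon> *\<^sub>R a' h)" "n' ?k = (1 / \<epsilon>) *\<^sub>R (\<epsilon> *\<^sub>R m' h)"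
    unfolding linear_cmul[OF lin(1)] linear_diff[OF lin(1)] linear_cmul[OF lin(2)] linear_diff[OF lin(2)]
      linear_cmul[OF lin(3)] linear_diff[OF lin(3)] eq[symmetric] by simp_all
  then have "z' h = y' ?k \<and> a' h = b' ?k \<and> m' h = n' ?k" using \<epsilon> by simp
  then show ?thesis by blast
qed

section \<open>Existence of smooth normal frames\<close>

lemma linear_coordinates:
  shows "linear (fst :: 'n::finite hcoords \<Rightarrow> real)"
    and "linear (\<lambda>x :: 'n hcoords. fst (snd x))"
    and "linear (\<lambda>x :: 'n hcoords. fst (snd (snd x)))"
    and "linear (\<lambda>x :: 'n hcoords. fst (snd (snd (snd x))))"
    and "linear (\<lambda>x :: 'n hcoords. snd (snd (snd (snd x))))"
  by (auto intro!: linearI)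

text \<open>The nonzero minor makes Y^0 and Y^(n+3) independent on each line; inverting this 2 x 2
  matrix smoothly produces the normalized spanning vectors.\<close>

lemma ex_normal_frame:
  fixes p q :: "real^'n::finite \<Rightarrow> 'n hcoords" and S :: "(real^'n) set"
  defines "e3 \<equiv> \<lambda>x :: 'n hcoords. snd (snd (snd (snd x)))"
  assumes S: "open S" and p: "smooth_on S p" and q: "smooth_on S q"
    and nz: "\<And>w. w \<in> S \<Longrightarrow> fst (p w) * e3 (q w) - e3 (p w) * fst (q w) \<noteq> 0"
  obtains y z :: "real^'n \<Rightarrow> real^'n" and a b m n :: "real^'n \<Rightarrow> real"
  where "smooth_on S y" "smooth_on S z" "smooth_on S a" "smooth_on S b" "smooth_on S m" "smooth_on S n"
    "\<And>w. w \<in> S \<Longrightarrow> p w = fst (p w) *\<^sub>R e0_frame y b n w + e3 (p w) *\<^sub>R e3_frame z a m w"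
    "\<And>w. w \<in> S \<Longrightarrow> q w = fst (q w) *\<^sub>R e0_frame y b n w + e3 (q w) *\<^sub>R e3_frame z a m w"
    "\<And>w. w \<in> S \<Longrightarrow> span {p w, q w} = span {e0_frame y b n w, e3_frame z a m w}"
    "\<And>w. w \<in> S \<Longrightarrow> stable_at p q w \<longleftrightarrow> stable_at (e0_frame y b n) (e3_frame z a m) w"
proof -
  define \<Delta> where "\<Delta> w = fst (p w) * e3 (q w) - e3 (p w) * fst (q w)" for w
  have coord: "smooth_on S (\<lambda>w. fst (p w))" "smooth_on S (\<lambda>w. fst (q w))"
    "smooth_on S (\<lambda>w. e3 (p w))" "smooth_on S (\<lambda>w. e3 (q w))"
    unfolding e3_def
    by (fact smooth_on_linear[OF S linear_coordinates(1) p] smooth_on_linear[OF S linear_coordinates(1) q]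
        smooth_on_linear[OF S linear_coordinates(5) p] smooth_on_linear[OF S linear_coordinates(5) q])+
  have neg: "smooth_on S (\<lambda>w. - F w)" if "smooth_on S F" for F :: "real^'n \<Rightarrow> real"
    by (rule smooth_on_linear[OF S _ that]) (auto intro: linearI)
  have "smooth_on S (\<lambda>w. fst (p w) * e3 (q w) + - (e3 (p w) * fst (q w)))"
    by (intro smooth_on_add smooth_on_mult neg coord S)
  then have inv: "smooth_on S (\<lambda>w. inverse (\<Delta> w))"
    using nz by (intro smooth_on_inverse S) (auto simp: \<Delta>_def)
  \<comment> \<open>Entries of the inverse of the matrix with rows (Y^0, Y^(n+3)) of
    \<open>p\<close> and of \<open>q\<close>.\<close>
  define \<alpha> \<beta> \<gamma> \<delta> where coeff: "\<alpha> w = e3 (q w) * inverse (\<Delta> w)" "\<beta> w = - (e3 (p w) * inverse (\<Delta> w))"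
    "\<gamma> w = - (fst (q w) * inverse (\<Delta> w))" "\<delta> w = fst (p w) * inverse (\<Delta> w)" for w
  have sc: "smooth_on S \<alpha>" "smooth_on S \<beta>" "smooth_on S \<gamma>" "smooth_on S \<delta>"
    unfolding coeff[abs_def] by (intro smooth_on_mult neg coord inv S)+
  define P Q where "P w = \<alpha> w *\<^sub>R p w + \<beta> w *\<^sub>R q w" and "Q w = \<gamma> w *\<^sub>R p w + \<delta> w *\<^sub>R q w" for w
  have sP: "smooth_on S P" and sQ: "smooth_on S Q"
    unfolding P_def[abs_def] Q_def[abs_def] by (intro smooth_on_add smooth_on_scaleR sc p q S)+
  have \<Delta>: "\<Delta> w * inverse (\<Delta> w) = 1" if "w \<in> S" for w using nz[OF that] by (simp add: \<Delta>_def)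
  have e3lin: "e3 (x + x') = e3 x + e3 x'" "e3 (c *\<^sub>R x) = c * e3 x" for c x x' by (simp_all add: e3_def)
  have norm: "fst (P w) = 1" "e3 (P w) = 0" "fst (Q w) = 0" "e3 (Q w) = 1" if "w \<in> S" for w
    using \<Delta>[OF that] unfolding P_def Q_def fst_add fst_scaleR e3lin coeff by (simp_all add: \<Delta>_def algebra_simps)
  define y b n where ybn: "y w = fst (snd (P w))" "b w = fst (snd (snd (P w)))" "n w = fst (snd (snd (snd (P w))))" for w
  define z a m where zam: "z w = fst (snd (Q w))" "a w = fst (snd (snd (Q w)))" "m w = fst (snd (snd (snd (Q w))))" for w
  have P: "P w = e0_frame y b n w" and Q: "Q w = e3_frame z a m w" if "w \<in> S" for w
    using norm[OF that] by (simp_all add: ybn zam e0_frame_def e3_frame_def e3_def prod_eq_iff)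
  have pPQ: "p w = fst (p w) *\<^sub>R e0_frame y b n w + e3 (p w) *\<^sub>R e3_frame z a m w" if "w \<in> S" for w
  proof -
    have "fst (p w) *\<^sub>R P w + e3 (p w) *\<^sub>R Q w = (\<Delta> w * inverse (\<Delta> w)) *\<^sub>R p w"
      unfolding P_def Q_def coeff by (simp add: \<Delta>_def algebra_simps)
    then show ?thesis unfolding P[OF that, symmetric] Q[OF that, symmetric] \<Delta>[OF that] by simp
  qed
  have qPQ: "q w = fst (q w) *\<^sub>R e0_frame y b n w + e3 (q w) *\<^sub>R e3_frame z a m w" if "w \<in> S" for w
  proof -
    have "fst (q w) *\<^sub>R P w + e3 (q w) *\<^sub>R Q w = (\<Delta> w * inverse (\<Delta> w)) *\<^sub>R q w"
      unfolding P_def Q_def coeff by (simp add: \<Delta>_def algebra_simps)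
    then show ?thesis unfolding P[OF that, symmetric] Q[OF that, symmetric] \<Delta>[OF that] by simp
  qed
  have diff: "F differentiable (at w)" if "w \<in> S" "smooth_on S F" for F :: "real^'n \<Rightarrow> 'b::real_normed_vector" and w
    using smooth_on_has_derivative[OF that(2,1)] by (auto simp: differentiable_def)
  have det: "\<alpha> w * \<delta> w - \<beta> w * \<gamma> w \<noteq> 0" if "w \<in> S" for w
  proof -
    have "\<alpha> w * \<delta> w - \<beta> w * \<gamma> w = \<Delta> w * inverse (\<Delta> w) * inverse (\<Delta> w)"
      unfolding coeff by (simp add: \<Delta>_def algebra_simps)
    then show ?thesis using \<Delta>[OF that] nz[OF that] by (simp add: \<Delta>_def)
  qed
  show ?thesis
  proof
    show "smooth_on S y" "smooth_on S z" "smooth_on S a" "smooth_on S b" "smooth_on S m" "smooth_on S n"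
      unfolding ybn[abs_def] zam[abs_def]
      by (fact smooth_on_linear[OF S linear_coordinates(2) sP] smooth_on_linear[OF S linear_coordinates(2) sQ]
          smooth_on_linear[OF S linear_coordinates(3) sP] smooth_on_linear[OF S linear_coordinates(3) sQ]
          smooth_on_linear[OF S linear_coordinates(4) sP] smooth_on_linear[OF S linear_coordinates(4) sQ])+
    show "span {p w, q w} = span {e0_frame y b n w, e3_frame z a m w}" if "w \<in> S" for w
    proof (rule antisym)
      have "p w \<in> span {e0_frame y b n w, e3_frame z a m w}" "q w \<in> span {e0_frame y b n w, e3_frame z a m w}"
        unfolding span_pair by (intro exI, rule pPQ[OF that], intro exI, rule qPQ[OF that])
      then show "span {p w, q w} \<subseteq> span {e0_frame y b n w, e3_frame z a m w}"
        by (intro span_minimal subspace_span) simp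
      have "P w \<in> span {p w, q w}" "Q w \<in> span {p w, q w}"
        unfolding span_pair P_def Q_def by (intro exI, rule refl)+
      then show "span {e0_frame y b n w, e3_frame z a m w} \<subseteq> span {p w, q w}"
        unfolding P[OF that] Q[OF that] by (intro span_minimal subspace_span) simp
    qed
    show "stable_at p q w \<longleftrightarrow> stable_at (e0_frame y b n) (e3_frame z a m) w" if w: "w \<in> S" for w
    proof
      assume "stable_at p q w"
      then show "stable_at (e0_frame y b n) (e3_frame z a m) w"
        by (rule stable_at_frame_change[OF S w diff[OF w p] diff[OF w q] sc[THEN diff[OF w]] _ _ det[OF w], rotated 2])
          (simp_all only: P[symmetric] Q[symmetric] P_def Q_def)
    next
      \<comment> \<open>The way back is again a frame change: its coefficients are the coordinates
        of \<open>p\<close> and \<open>q\<close>, and its determinant is the minor in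
        \<open>nz\<close>.\<close>
      have "smooth_on S (e0_frame y b n)" "smooth_on S (e3_frame z a m)"
        using smooth_on_cong[OF S P sP] smooth_on_cong[OF S Q sQ] by simp_all
      note dPQ = this[THEN diff[OF w]]
      assume "stable_at (e0_frame y b n) (e3_frame z a m) w"
      then show "stable_at p q w"
        by (rule stable_at_frame_change[OF S w dPQ coord(1,3,2,4)[THEN diff[OF w]] pPQ qPQ nz[OF w], rotated 2])
    qed
  qed (fact pPQ qPQ)+
qed

section \<open>The two implications\<close>

lemma span_pair_linear_image:
  assumes "linear g"
  shows "g ` span {x, y} = span {g x, g y}"
  using linear_span_image[OF assms, of "{x, y}"] by simp

text \<open>The normal frame has the identity as its matrix of coordinates (Y^0, Y^(n+3)); by
  multiplicativity of determinants the corresponding minor of \<open>x\<close>, \<open>x'\<close>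
  divides 1.\<close>

lemma frame_coordinate_det_nonzero:
  fixes x x' :: "'n::finite hcoords"
  assumes "span {x, x'} = span {e0_frame y b n w, e3_frame z a m w}"
  shows "fst x * snd (snd (snd (snd x'))) - snd (snd (snd (snd x))) * fst x' \<noteq> 0"
proof -
  have "e0_frame y b n w \<in> span {x, x'}" "e3_frame z a m w \<in> span {x, x'}"
    unfolding assms by (auto intro: span_base)
  then obtain c c' d d' where eq: "e0_frame y b n w = c *\<^sub>R x + c' *\<^sub>R x'" "e3_frame z a m w = d *\<^sub>R x + d' *\<^sub>R x'"
    unfolding span_pair by (elim exE)
  have c: "c * fst x + c' * fst x' = 1" "c * snd (snd (snd (snd x))) + c' * snd (snd (snd (snd x'))) = 0"
    using arg_cong[OF eq(1), of fst] arg_cong[OF eq(1), of "\<lambda>x. snd (snd (snd (snd x)))"]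
    by (simp_all add: e0_frame_def)
  have d: "d * fst x + d' * fst x' = 0" "d * snd (snd (snd (snd x))) + d' * snd (snd (snd (snd x'))) = 1"
    using arg_cong[OF eq(2), of fst] arg_cong[OF eq(2), of "\<lambda>x. snd (snd (snd (snd x)))"]
    by (simp_all add: e3_frame_def)
  have "(c * fst x + c' * fst x') * (d * snd (snd (snd (snd x))) + d' * snd (snd (snd (snd x'))))
      - (c * snd (snd (snd (snd x))) + c' * snd (snd (snd (snd x')))) * (d * fst x + d' * fst x')
    = (c * d' - c' * d) * (fst x * snd (snd (snd (snd x'))) - snd (snd (snd (snd x))) * fst x')"
    by (simp add: algebra_simps)
  then show ?thesis unfolding c d by auto
qed

text \<open>A point of the line is determined by (Y^0, Y^(n+3)), so the normal frame of a system
  line reveals the parameter \<open>u\<close> as well as the values of all five functions.\<close>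

lemma frames_in_system_line:
  assumes "span {e0_frame y b n w, e3_frame z a m w} = system_line f B A N M u"
  shows "y w = u" "b w = B u" "n w = N u" "z w = f u" "a w = A u" "m w = M u"
proof -
  have "e0_frame y b n w \<in> system_line f B A N M u" "e3_frame z a m w \<in> system_line f B A N M u"
    unfolding assms[symmetric] by (auto intro: span_base)
  then show "y w = u" "b w = B u" "n w = N u" "z w = f u" "a w = A u" "m w = M u"
    by (auto simp: e0_frame_def e3_frame_def system_line_def vec_eq_iff)
qed

text \<open>After undoing \<open>g\<close>, the normal frame consists of the functions of the system
  composed with the correspondence of parameters, so the chain rule turns the laws into the
  relations of \<open>stable_at_normal_frame\<close>.\<close>

lemma hypersurface_of_system_imp_stable:
  fixes p q :: "real^'n::finite \<Rightarrow> 'n hcoords"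
  assumes V: "open V" and p: "smooth_on V p" and q: "smooth_on V q"
    and sys: "hypersurface_of_system V p q"
  shows "stable_tangent_spaces V p q"
proof -
  obtain W :: "(real^'n) set" and f B A N M and g :: "'n hcoords \<Rightarrow> 'n hcoords"
    where laws: "system_with_two_laws W f B A N M" and g: "linear g" "bij g"
      and gen: "generator p q ` V = (\<lambda>u. g ` system_line f B A N M u) ` W"
    using sys unfolding hypersurface_of_system_def by (elim exE conjE) (rule that)
  define k where "k = inv g"
  have k: "linear k" unfolding k_def by (rule inj_linear_imp_inv_linear[OF g(1) bij_is_inj[OF g(2)]])
  have kg: "k (g x) = x" and gk: "g (k x) = x" for x
    unfolding k_def by (rule inv_f_f[OF bij_is_inj[OF g(2)]], rule surj_f_inv_f[OF bij_is_surj[OF g(2)]])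
  \<comment> \<open>The correspondence of parameters is chosen separately on each line, with no
    continuity at this stage.\<close>
  define \<phi> where "\<phi> v = (SOME u. u \<in> W \<and> generator p q v = g ` system_line f B A N M u)" for v
  have \<phi>: "\<phi> v \<in> W" "generator p q v = g ` system_line f B A N M (\<phi> v)" if "v \<in> V" for v
  proof -
    have "\<exists>u. u \<in> W \<and> generator p q v = g ` system_line f B A N M u"
      using gen that by (metis (no_types, lifting) imageE imageI)
    from someI_ex[OF this] show "\<phi> v \<in> W" "generator p q v = g ` system_line f B A N M (\<phi> v)"
      unfolding \<phi>_def by blast+
  qed
  have line: "span {k (p v), k (q v)} = system_line f B A N M (\<phi> v)" if "v \<in> V" for v
  proof -
    have "span {k (p v), k (q v)} = k ` generator p q v"
      unfolding generator_def by (rule span_pair_linear_image[OF k, symmetric])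
    also have "\<dots> = system_line f B A N M (\<phi> v)" unfolding \<phi>(2)[OF that] by (simp add: image_image kg)
    finally show ?thesis .
  qed
  note kp = smooth_on_linear[OF V k p] and kq = smooth_on_linear[OF V k q]
  have det: "fst (k (p w)) * snd (snd (snd (snd (k (q w))))) - snd (snd (snd (snd (k (p w))))) * fst (k (q w)) \<noteq> 0"
    if "w \<in> V" for w
    by (rule frame_coordinate_det_nonzero[OF line[OF that, unfolded system_line_eq_span]])
  obtain y z a b m n where sm: "smooth_on V y" "smooth_on V z" "smooth_on V a" "smooth_on V b" "smooth_on V m" "smooth_on V n"
    and sp: "\<And>w. w \<in> V \<Longrightarrow> span {k (p w), k (q w)} = span {e0_frame y b n w, e3_frame z a m w}"
    and st: "\<And>w. w \<in> V \<Longrightarrow> stable_at (\<lambda>w. k (p w)) (\<lambda>w. k (q w)) w \<longleftrightarrow> stable_at (e0_frame y b n) (e3_frame z a m) w"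
  proof (rule ex_normal_frame[OF V kp kq det])
    fix w assume "w \<in> V" then show "w \<in> V" .
  next
    fix y z a b m n
    assume "smooth_on V y" "smooth_on V z" "smooth_on V a" "smooth_on V b" "smooth_on V m" "smooth_on V n"
      "\<And>w. w \<in> V \<Longrightarrow> span {k (p w), k (q w)} = span {e0_frame y b n w, e3_frame z a m w}"
      "\<And>w. w \<in> V \<Longrightarrow> stable_at (\<lambda>w. k (p w)) (\<lambda>w. k (q w)) w \<longleftrightarrow> stable_at (e0_frame y b n) (e3_frame z a m) w"
    then show thesis by (rule that)
  qed
  \<comment> \<open>Since \<open>\<phi>\<close> coincides with the component \<open>y\<close> of a
    smooth frame, it is smooth on \<open>V\<close>.\<close>
  have eq: "y w = \<phi> w" "b w = B (\<phi> w)" "n w = N (\<phi> w)" "z w = f (\<phi> w)" "a w = A (\<phi> w)" "m w = M (\<phi> w)" if "w \<in> V" for w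
    using frames_in_system_line[OF trans[OF sp[OF that, symmetric] line[OF that]]] by simp_all
  have smooth: "smooth_on W f" "smooth_on W B" "smooth_on W A" "smooth_on W N" "smooth_on W M"
    using laws by (auto simp: system_with_two_laws_def additional_conservation_law_def)
  show ?thesis unfolding stable_tangent_spaces_iff
  proof
    fix v assume v: "v \<in> V"
    note hW = smooth[THEN smooth_on_has_derivative, OF \<phi>(1)[OF v]]
    note hV = sm[THEN smooth_on_has_derivative, OF v]
    let ?D = "\<lambda>F. frechet_derivative F (at (\<phi> v))"
    have chain: "frechet_derivative x (at v) = (\<lambda>h. X' (frechet_derivative y (at v) h))"
      if X: "(X has_derivative X') (at (\<phi> v))" and x: "\<And>w. w \<in> V \<Longrightarrow> x w = X (\<phi> w)"
      for X :: "real^'n \<Rightarrow> 'z::real_normed_vector" and X' x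
    proof -
      have "((\<lambda>w. X (y w)) has_derivative (\<lambda>h. X' (frechet_derivative y (at v) h))) (at v)"
        by (rule has_derivative_compose[OF hV(1)]) (simp add: eq(1)[OF v] X)
      then have "(x has_derivative (\<lambda>h. X' (frechet_derivative y (at v) h))) (at v)"
        by (rule has_derivative_transform_within_open[OF _ V v]) (simp add: x eq(1))
      from frechet_derivative_at[OF this] show ?thesis by simp
    qed
    have "?D A h = ?D B (?D f h)" "?D M h = ?D N (?D f h)" for h
    proof -
      have "additional_conservation_law W f B A" "additional_conservation_law W f N M"
        using laws by (simp_all add: system_with_two_laws_def)
      from this[unfolded additional_conservation_law_def, THEN conjunct2, THEN conjunct2, THEN bspec, OF \<phi>(1)[OF v]]
      show "?D A h = ?D B (?D f h)" "?D M h = ?D N (?D f h)"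
        unfolding conservation_law_iff[OF hW(2) hW(3) hW(1)] conservation_law_iff[OF hW(4) hW(5) hW(1)] by blast+
    qed
    note laws_at = this
    have "stable_at (e0_frame y b n) (e3_frame z a m) v"
      by (rule stable_at_normal_frame[OF hV(1) hV(4) hV(6) hV(2) hV(3) hV(5)
            has_derivative_linear[OF hW(2)] has_derivative_linear[OF hW(4)]])
        (simp_all add: chain[OF hW(1) eq(4)] chain[OF hW(2) eq(2)] chain[OF hW(3) eq(5)] chain[OF hW(4) eq(3)]
          chain[OF hW(5) eq(6)] laws_at)
    then have "stable_at (\<lambda>w. k (p w)) (\<lambda>w. k (q w)) v" using st[OF v] by blast
    moreover have "(\<lambda>w. k (p w)) differentiable (at v)" "(\<lambda>w. k (q w)) differentiable (at v)"
      using smooth_on_has_derivative[OF kp v] smooth_on_has_derivative[OF kq v] by (auto simp: differentiable_def)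
    ultimately have "stable_at (\<lambda>w. g (k (p w))) (\<lambda>w. g (k (q w))) v"
      by (intro stable_at_linear[OF _ _ g(1) bij_is_inj[OF g(2)]])
    then show "stable_at p q v" by (simp add: gk)
  qed
qed

section \<open>From stable tangent spaces to a system\<close>

text \<open>\<open>P\<close>, \<open>Q\<close> and the images of the axes under \<open>D\<close> are
  n + 2 independent vectors; two more complete them to a basis, which \<open>g\<close> matches with
  the standard one.\<close>

lemma ex_adapted_coordinates:
  fixes P Q :: "'n::finite hcoords" and D :: "real^'n \<Rightarrow> 'n hcoords"
  assumes D: "linear D" and ind: "\<And>h a b. D h + a *\<^sub>R P + b *\<^sub>R Q = 0 \<Longrightarrow> h = 0 \<and> a = 0 \<and> b = 0"
  obtains g :: "'n hcoords \<Rightarrow> 'n hcoords"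
  where "linear g" "bij g" "g (1, 0, 0, 0, 0) = P" "g (0, 0, 0, 0, 1) = Q" "\<And>h. g (0, h, 0, 0, 0) = D h"
proof -
  \<comment> \<open>The ambient dimension is n + 4, which leaves room for exactly two successive
    choices, \<open>x\<close> and \<open>x'\<close>.\<close>
  have not_full: "\<exists>x. x \<notin> S" if "subspace S" "dim S \<le> CARD('n) + 3" for S :: "'n hcoords set"
  proof (rule ccontr)
    assume "\<not> ?thesis"
    then have "S = UNIV" by blast
    then show False using that(2) by simp
  qed
  define L where "L = (\<lambda>(h, a, b). D h + a *\<^sub>R P + b *\<^sub>R Q)"
  have L: "linear L" unfolding L_def
    by (rule linearI) (auto simp: linear_add[OF D] linear_cmul[OF D] algebra_simps)
  have "dim (range L) \<le> dim (UNIV :: ((real^'n) \<times> real \<times> real) set)" by (rule dim_image_le[OF L])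
  then have dim: "dim (range L) \<le> CARD('n) + 2" by simp
  have sub: "subspace (range L)" by (rule linear_subspace_image[OF L subspace_UNIV])
  obtain x where x: "x \<notin> range L" using not_full[OF sub] dim by auto
  define S where "S = span (insert x (range L))"
  have "dim S \<le> CARD('n) + 3" using dim by (simp add: S_def dim_insert)
  then obtain x' where x': "x' \<notin> S" using not_full[of S] by (auto simp: S_def)
  define g where "g = (\<lambda>(a, h, c, d, b). L (h, a, b) + c *\<^sub>R x + d *\<^sub>R x')"
  have g: "linear g"
  proof (rule linearI)
    show "g (u + w) = g u + g w" for u w
      using linear_add[OF L] by (cases u; cases w) (simp add: g_def L_def linear_add[OF D] algebra_simps)
    show "g (r *\<^sub>R u) = r *\<^sub>R g u" for r u
      by (cases u) (simp add: g_def L_def linear_cmul[OF D] algebra_simps)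
  qed
  have "inj g" unfolding linear_injective_0[OF g]
  proof (intro allI impI)
    fix u assume *: "g u = 0"
    obtain a h c d b where u: "u = (a, h, c, d, b)" by (cases u)
    have eq: "L (h, a, b) + c *\<^sub>R x + d *\<^sub>R x' = 0" using * by (simp add: g_def u)
    have inS: "L (h, a, b) \<in> S" "x \<in> S" by (auto simp: S_def intro: span_base)
    have "subspace S" by (simp add: S_def)
    \<comment> \<open>The coefficients vanish in the reverse order of the choices: \<open>x'\<close>
      lies outside \<open>S\<close>, \<open>x\<close> outside \<open>range L\<close>, and
      \<open>ind\<close> settles the rest.\<close>
    have d: "d = 0"
    proof (rule ccontr)
      assume "d \<noteq> 0"
      have "d *\<^sub>R x' = - (L (h, a, b) + c *\<^sub>R x)" by (rule minus_unique[OF eq, symmetric])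
      moreover have "- (L (h, a, b) + c *\<^sub>R x) \<in> S"
        by (intro subspace_neg subspace_add subspace_mul \<open>subspace S\<close> inS)
      ultimately have "inverse d *\<^sub>R (d *\<^sub>R x') \<in> S" using subspace_mul[OF \<open>subspace S\<close>] by simp
      then have "x' \<in> S" using \<open>d \<noteq> 0\<close> by simp
      with x' show False by blast
    qed
    have c: "c = 0"
    proof (rule ccontr)
      assume "c \<noteq> 0"
      have "c *\<^sub>R x = - L (h, a, b)" using eq d by (simp add: eq_neg_iff_add_eq_0 add.commute)
      then have "c *\<^sub>R x \<in> range L" using subspace_neg[OF sub rangeI] by simp
      then have "inverse c *\<^sub>R (c *\<^sub>R x) \<in> range L" by (rule subspace_mul[OF sub])
      then have "x \<in> range L" using \<open>c \<noteq> 0\<close> by simp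
      with x show False by blast
    qed
    have "h = 0 \<and> a = 0 \<and> b = 0" using eq c d by (intro ind) (simp add: L_def)
    with c d show "u = 0" by (simp add: u zero_prod_def)
  qed
  then have "bij g" using linear_injective_imp_surjective[OF g] by (simp add: bij_def)
  moreover have "g (1, 0, 0, 0, 0) = P" "g (0, 0, 0, 0, 1) = Q" "g (0, h, 0, 0, 0) = D h" for h
    by (simp_all add: g_def L_def linear_0[OF D])
  ultimately show thesis using that g by blast
qed

text \<open>The coefficients of a linear relation form a covector that annihilates every system
  line; carried over by \<open>g\<close>, it would put all generators in a hyperplane.\<close>

lemma independent_laws_of_nondegenerate:
  fixes p q :: "real^'n::finite \<Rightarrow> 'n hcoords" and g :: "'n hcoords \<Rightarrow> 'n hcoords"
  assumes nd: "nondegenerate V p q" and g: "linear g" "bij g"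
    and gen: "\<And>v. v \<in> V \<Longrightarrow> \<exists>u\<in>W. generator p q v = g ` system_line f B A N M u"
  shows "independent_laws W f B A N M"
  unfolding independent_laws_def
proof (intro allI impI)
  fix a b c d e
  assume *: "\<forall>z \<in> W \<times> UNIV. \<forall>h.
           a * dx_dt_form (\<lambda>_. 1) (\<lambda>_. 0) z h + b * dx_dt_form (\<lambda>_. 0) (\<lambda>_. 1) z h
           + (\<Sum>i\<in>UNIV. c i * dx_dt_form (\<lambda>u. u $ i) (\<lambda>u. f u $ i) z h)
           + d * dx_dt_form B A z h + e * dx_dt_form N M z h = 0"
  define k where "k = inv g"
  have k: "linear k" unfolding k_def by (rule inj_linear_imp_inv_linear[OF g(1) bij_is_inj[OF g(2)]])
  have kg: "k (g x) = x" for x unfolding k_def by (rule inv_f_f[OF bij_is_inj[OF g(2)]])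
  \<comment> \<open>Here dx corresponds to Y^0 and dt to Y^(n+3), hence \<open>b\<close> comes last.
    Evaluating the relation on the x and t directions pairs \<open>\<xi>\<close> with the two
    spanning vectors of the line.\<close>
  define \<xi> :: "'n hcoords" where "\<xi> = (a, (\<chi> i. c i), d, e, b)"
  have "\<xi> \<bullet> e0_frame (\<lambda>u. u) B N u = 0" "\<xi> \<bullet> e3_frame f A M u = 0" if "u \<in> W" for u
    using bspec[OF *, of "(u, 0, 0)", THEN spec, of "(0, 1, 0)"] bspec[OF *, of "(u, 0, 0)", THEN spec, of "(0, 0, 1)"] that
    by (simp_all add: \<xi>_def e0_frame_def e3_frame_def dx_dt_form_def inner_vec_def)
  then have line: "\<xi> \<bullet> x = 0" if "u \<in> W" "x \<in> system_line f B A N M u" for u x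
    using that by (auto simp: system_line_eq_span span_pair inner_add_right simp del: inner_Pair)
  \<comment> \<open>Covectors move by the adjoint of the inverse: \<open>adjoint k \<xi>\<close>
    takes on \<open>g y\<close> the value of \<open>\<xi>\<close> on \<open>y\<close>.\<close>
  have "(\<Union>v\<in>V. generator p q v) \<subseteq> {x. adjoint k \<xi> \<bullet> x = 0}"
  proof (intro UN_least subsetI CollectI)
    fix v x assume "v \<in> V" "x \<in> generator p q v"
    then obtain u y where "u \<in> W" "x = g y" "y \<in> system_line f B A N M u" using gen[of v] by auto
    then show "adjoint k \<xi> \<bullet> x = 0"
      using line kg by (simp only: adjoint_clauses(2)[OF k])
  qed
  then have "adjoint k \<xi> = 0" using nd unfolding nondegenerate_def by blast
  then have "\<xi> \<bullet> k x = 0" for x using adjoint_clauses(2)[OF k, of \<xi> x] by simp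
  from this[of "g \<xi>"] have "\<xi> = 0" by (simp only: kg inner_eq_zero_iff)
  then show "a = 0 \<and> b = 0 \<and> (\<forall>i. c i = 0) \<and> d = 0 \<and> e = 0"
    by (simp add: \<xi>_def zero_prod_def vec_eq_iff)
qed

text \<open>The neighbourhood shrinks twice, first to keep a normal frame and then to invert
  \<open>y\<close>; hence nondegeneracy is assumed on every smaller neighbourhood of
  \<open>v0\<close>.\<close>

lemma stable_imp_hypersurface_of_system:
  fixes p q :: "real^'n::finite \<Rightarrow> 'n hcoords"
  assumes V: "open V" "v0 \<in> V" and p: "smooth_on V p" and q: "smooth_on V q"
    and stable: "stable_tangent_spaces V p q" and smooth0: "smooth_point p q v0 s t"
    and nd: "\<And>V'. open V' \<Longrightarrow> v0 \<in> V' \<Longrightarrow> V' \<subseteq> V \<Longrightarrow> nondegenerate V' p q"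
  shows "\<exists>V'. open V' \<and> v0 \<in> V' \<and> V' \<subseteq> V \<and> hypersurface_of_system V' p q"
proof -
  \<comment> \<open>The determinant of the frame change to \<open>p0\<close>, \<open>q0\<close>, in
    the shape required by \<open>stable_at_frame_change\<close>; it equals s^2 + t^2. The change
    moves the given smooth point to \<open>p0 v0\<close>.\<close>
  define r where "r = s * s - t * - t"
  have "(s, t) \<noteq> (0, 0)" using smooth0 by (simp add: smooth_point_def)
  then have r: "r \<noteq> 0" using sum_squares_gt_zero_iff[of s t] by (auto simp: r_def)
  define p0 q0 where "p0 w = s *\<^sub>R p w + t *\<^sub>R q w" and "q0 w = (- t) *\<^sub>R p w + s *\<^sub>R q w" for w
  have sm0: "smooth_on V p0" "smooth_on V q0"
    unfolding p0_def[abs_def] q0_def[abs_def]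
    by (intro smooth_on_add smooth_on_scaleR smooth_on_const V p q)+
  have gen0: "generator p q w = span {p0 w, q0 w}" for w
  proof -
    have "s *\<^sub>R p0 w + (- t) *\<^sub>R q0 w = r *\<^sub>R p w" "t *\<^sub>R p0 w + s *\<^sub>R q0 w = r *\<^sub>R q w"
      by (simp_all add: p0_def q0_def r_def algebra_simps)
    then have inv: "inverse r *\<^sub>R (s *\<^sub>R p0 w + (- t) *\<^sub>R q0 w) = p w" "inverse r *\<^sub>R (t *\<^sub>R p0 w + s *\<^sub>R q0 w) = q w"
      using r by simp_all
    have "inverse r *\<^sub>R (c *\<^sub>R p0 w + d *\<^sub>R q0 w) \<in> span {p0 w, q0 w}" for c d
      by (intro span_scale span_add span_base) auto
    note combination = this
    have "p w \<in> span {p0 w, q0 w}" "q w \<in> span {p0 w, q0 w}"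
      unfolding inv[symmetric] by (rule combination)+
    moreover have "p0 w \<in> span {p w, q w}" "q0 w \<in> span {p w, q w}"
      unfolding p0_def q0_def by (intro span_scale span_add span_base; simp)+
    ultimately show ?thesis
      unfolding generator_def by (intro subset_antisym span_minimal subspace_span) auto
  qed
  have stable0: "stable_at p0 q0 w" if "w \<in> V" for w
  proof (rule stable_at_frame_change[OF V(1) that, of p q "\<lambda>_. s" "\<lambda>_. t" "\<lambda>_. - t" "\<lambda>_. s"])
    show "p differentiable (at w)" "q differentiable (at w)"
      using smooth_on_has_derivative[OF p that] smooth_on_has_derivative[OF q that] by (auto simp: differentiable_def)
    show "s * s - t * - t \<noteq> 0" using r by (simp add: r_def)
    show "stable_at p q w" using stable that by (simp add: stable_tangent_spaces_iff)
  qed (simp_all only: p0_def q0_def differentiable_const)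
  define D where "D = frechet_derivative p0 (at v0)"
  have dp0: "(p0 has_derivative D) (at v0)" unfolding D_def by (rule smooth_on_has_derivative[OF sm0(1) V(2)])
  note D = has_derivative_linear[OF dp0]
  \<comment> \<open>Smoothness of the point \<open>p0 v0\<close>, spelled out as independence; this
    is what the adapted coordinates need.\<close>
  have ind: "h = 0 \<and> a = 0 \<and> b = 0" if 0: "D h + a *\<^sub>R p0 v0 + b *\<^sub>R q0 v0 = 0" for h a b
  proof -
    note dp = smooth_on_has_derivative[OF p V(2)] and dq = smooth_on_has_derivative[OF q V(2)]
    have "(p0 has_derivative (\<lambda>h. s *\<^sub>R frechet_derivative p (at v0) h + t *\<^sub>R frechet_derivative q (at v0) h)) (at v0)"
      unfolding p0_def[abs_def] by (intro has_derivative_add has_derivative_scaleR_right dp dq)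
    then have Dh: "D h = s *\<^sub>R frechet_derivative p (at v0) h + t *\<^sub>R frechet_derivative q (at v0) h"
      by (rule fun_cong[OF has_derivative_unique[OF dp0]])
    have "s *\<^sub>R frechet_derivative p (at v0) h + t *\<^sub>R frechet_derivative q (at v0) h
        + (a * s - b * t) *\<^sub>R p v0 + (a * t + b * s) *\<^sub>R q v0 = 0"
      using 0 unfolding Dh p0_def q0_def by (simp add: algebra_simps)
    from smooth0[unfolded smooth_point_iff[OF dp dq], THEN conjunct2, rule_format, OF this]
    have *: "h = 0" "a * s - b * t = 0" "a * t + b * s = 0" by blast+
    have "a * r = (a * s - b * t) * s + (a * t + b * s) * t" "b * r = (a * t + b * s) * s - (a * s - b * t) * t"
      by (simp_all add: r_def algebra_simps)
    then have "a * r = 0" "b * r = 0" unfolding * by simp_all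
    with r *(1) show ?thesis by simp
  qed
  obtain g :: "'n hcoords \<Rightarrow> 'n hcoords" where g: "linear g" "bij g"
    and g0: "g (1, 0, 0, 0, 0) = p0 v0" "g (0, 0, 0, 0, 1) = q0 v0" "\<And>h. g (0, h, 0, 0, 0) = D h"
    by (rule ex_adapted_coordinates[OF D ind]) (assumption | rule that)+
  define k where "k = inv g"
  have k: "linear k" unfolding k_def by (rule inj_linear_imp_inv_linear[OF g(1) bij_is_inj[OF g(2)]])
  have kg: "k (g x) = x" and gk: "g (k x) = x" for x
    unfolding k_def by (rule inv_f_f[OF bij_is_inj[OF g(2)]], rule surj_f_inv_f[OF bij_is_surj[OF g(2)]])
  have k0: "k (p0 v0) = (1, 0, 0, 0, 0)" "k (q0 v0) = (0, 0, 0, 0, 1)" "k (D h) = (0, h, 0, 0, 0)" for h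
    unfolding g0[symmetric] kg by simp_all
  \<comment> \<open>The minor needed for a normal frame; it equals 1 at \<open>v0\<close> by the
    choice of \<open>g\<close>, hence stays nonzero nearby.\<close>
  define \<Delta> where "\<Delta> w = fst (k (p0 w)) * snd (snd (snd (snd (k (q0 w))))) - snd (snd (snd (snd (k (p0 w))))) * fst (k (q0 w))" for w
  define S where "S = {w \<in> V. \<Delta> w \<noteq> 0}"
  have kp: "smooth_on V (\<lambda>w. k (p0 w))" and kq: "smooth_on V (\<lambda>w. k (q0 w))"
    by (fact smooth_on_linear[OF V(1) k sm0(1)] smooth_on_linear[OF V(1) k sm0(2)])+
  have "continuous_on V \<Delta>"
    unfolding \<Delta>_def[abs_def]
    by (intro continuous_on_diff continuous_on_mult
        kp[THEN smooth_on_linear[OF V(1) linear_coordinates(1)], THEN smooth_on_imp_continuous_on]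
        kp[THEN smooth_on_linear[OF V(1) linear_coordinates(5)], THEN smooth_on_imp_continuous_on]
        kq[THEN smooth_on_linear[OF V(1) linear_coordinates(1)], THEN smooth_on_imp_continuous_on]
        kq[THEN smooth_on_linear[OF V(1) linear_coordinates(5)], THEN smooth_on_imp_continuous_on])
  then have "open (V \<inter> \<Delta> -` (- {0}))" using V(1) by (intro continuous_open_preimage) auto
  moreover have "V \<inter> \<Delta> -` (- {0}) = S" by (auto simp: S_def)
  ultimately have S: "open S" "S \<subseteq> V" "v0 \<in> S" using V(2) by (auto simp: S_def \<Delta>_def k0)
  note kpS = smooth_on_subset[OF kp S(2)] and kqS = smooth_on_subset[OF kq S(2)]
  obtain y z :: "real^'n \<Rightarrow> real^'n" and a b m n :: "real^'n \<Rightarrow> real"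
    where sm: "smooth_on S y" "smooth_on S z" "smooth_on S a" "smooth_on S b" "smooth_on S m" "smooth_on S n"
    and kp_eq: "\<And>w. w \<in> S \<Longrightarrow> k (p0 w) = fst (k (p0 w)) *\<^sub>R e0_frame y b n w + snd (snd (snd (snd (k (p0 w))))) *\<^sub>R e3_frame z a m w"
    and kq_eq: "\<And>w. w \<in> S \<Longrightarrow> k (q0 w) = fst (k (q0 w)) *\<^sub>R e0_frame y b n w + snd (snd (snd (snd (k (q0 w))))) *\<^sub>R e3_frame z a m w"
    and sp: "\<And>w. w \<in> S \<Longrightarrow> span {k (p0 w), k (q0 w)} = span {e0_frame y b n w, e3_frame z a m w}"
    and st: "\<And>w. w \<in> S \<Longrightarrow> stable_at (\<lambda>w. k (p0 w)) (\<lambda>w. k (q0 w)) w \<longleftrightarrow> stable_at (e0_frame y b n) (e3_frame z a m) w"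
  proof (rule ex_normal_frame[OF S(1) kpS kqS])
    fix w assume "w \<in> S" then show "fst (k (p0 w)) * snd (snd (snd (snd (k (q0 w))))) - snd (snd (snd (snd (k (p0 w))))) * fst (k (q0 w)) \<noteq> 0"
      by (simp add: S_def \<Delta>_def)
  next
    fix y z :: "real^'n \<Rightarrow> real^'n" and a b m n :: "real^'n \<Rightarrow> real"
    assume "smooth_on S y" "smooth_on S z" "smooth_on S a" "smooth_on S b" "smooth_on S m" "smooth_on S n"
      "\<And>w. w \<in> S \<Longrightarrow> k (p0 w) = fst (k (p0 w)) *\<^sub>R e0_frame y b n w + snd (snd (snd (snd (k (p0 w))))) *\<^sub>R e3_frame z a m w"
      "\<And>w. w \<in> S \<Longrightarrow> k (q0 w) = fst (k (q0 w)) *\<^sub>R e0_frame y b n w + snd (snd (snd (snd (k (q0 w))))) *\<^sub>R e3_frame z a m w"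
      "\<And>w. w \<in> S \<Longrightarrow> span {k (p0 w), k (q0 w)} = span {e0_frame y b n w, e3_frame z a m w}"
      "\<And>w. w \<in> S \<Longrightarrow> stable_at (\<lambda>w. k (p0 w)) (\<lambda>w. k (q0 w)) w \<longleftrightarrow> stable_at (e0_frame y b n) (e3_frame z a m) w"
    then show thesis by (rule that)
  qed
  have yz0: "y v0 = 0" "z v0 = 0"
    using kp_eq[OF S(3)] kq_eq[OF S(3)] by (simp_all add: k0 e0_frame_def e3_frame_def)
  \<comment> \<open>The middle block of \<open>k (p0 w)\<close> combines \<open>y\<close> and
    \<open>z\<close> with coefficients 1 and 0 at \<open>v0\<close>. As \<open>y\<close> and
    \<open>z\<close> vanish there, its derivative is that of \<open>y\<close>, while
    \<open>k0\<close> makes it the identity.\<close>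
  have dy0: "(y has_derivative (\<lambda>h. h)) (at v0)"
  proof -
    note hy = smooth_on_has_derivative[OF sm(1) S(3)] and hz = smooth_on_has_derivative[OF sm(2) S(3)]
    have lin: "((\<lambda>w. L (k (p0 w))) has_derivative (\<lambda>h. L (k (D h)))) (at v0)"
      if "linear L" for L :: "'n hcoords \<Rightarrow> 'z::euclidean_space"
      by (rule bounded_linear.has_derivative[OF linear_linear[THEN iffD2, OF that]
            bounded_linear.has_derivative[OF linear_linear[THEN iffD2, OF k] dp0]])
    have "((\<lambda>w. fst (snd (k (p0 w)))) has_derivative (\<lambda>h. h)) (at v0)"
      using lin[OF linear_coordinates(2)] by (simp add: k0)
    then have "((\<lambda>w. fst (k (p0 w)) *\<^sub>R y w + snd (snd (snd (snd (k (p0 w))))) *\<^sub>R z w) has_derivative (\<lambda>h. h)) (at v0)"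
    proof (rule has_derivative_transform_within_open[OF _ S(1,3)])
      fix w assume "w \<in> S"
      from arg_cong[OF kp_eq[OF this], of "\<lambda>x. fst (snd x)"]
      show "fst (snd (k (p0 w))) = fst (k (p0 w)) *\<^sub>R y w + snd (snd (snd (snd (k (p0 w))))) *\<^sub>R z w"
        by (simp add: e0_frame_def e3_frame_def)
    qed
    moreover have "((\<lambda>w. fst (k (p0 w)) *\<^sub>R y w + snd (snd (snd (snd (k (p0 w))))) *\<^sub>R z w) has_derivative
        frechet_derivative y (at v0)) (at v0)"
      using has_derivative_add[OF has_derivative_scaleR[OF lin[OF linear_coordinates(1)] hy]
          has_derivative_scaleR[OF lin[OF linear_coordinates(5)] hz]]
      by (simp add: k0 yz0)
    ultimately have "frechet_derivative y (at v0) = (\<lambda>h. h)" by (rule has_derivative_unique[rotated])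
    then show ?thesis using hy by simp
  qed
  obtain V' W \<psi> where V': "open V'" "v0 \<in> V'" "V' \<subseteq> S" "open W" "homeomorphism V' W y \<psi>"
    and \<psi>: "smooth_on W \<psi>" and inj: "\<And>v. v \<in> V' \<Longrightarrow> inj (frechet_derivative y (at v))"
    by (rule smooth_inverse_function[OF S(1,3) sm(1) dy0]) (rule that)
  have W: "\<psi> u \<in> V'" "y (\<psi> u) = u" if "u \<in> W" for u using V'(5) that by (auto simp: homeomorphism_def)
  have y: "y v \<in> W" "\<psi> (y v) = v" if "v \<in> V'" for v using V'(5) that by (auto simp: homeomorphism_def)
  \<comment> \<open>The system is the normal frame written in the new parameter
    \<open>u = y v\<close>.\<close>
  define f B A N M where fBANM: "f u = z (\<psi> u)" "B u = b (\<psi> u)" "A u = a (\<psi> u)" "N u = n (\<psi> u)" "M u = m (\<psi> u)" for u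
  have "\<psi> ` W \<subseteq> S" using W V'(3) by auto
  note comp = smooth_on_compose[OF V'(4) S(1) this \<psi>]
  have smW: "smooth_on W f" "smooth_on W B" "smooth_on W A" "smooth_on W N" "smooth_on W M"
    unfolding fBANM[abs_def] by (intro comp sm)+
  have law: "frechet_derivative A (at u) h = frechet_derivative B (at u) (frechet_derivative f (at u) h)
    \<and> frechet_derivative M (at u) h = frechet_derivative N (at u) (frechet_derivative f (at u) h)" if u: "u \<in> W" for u h
  proof -
    define v where "v = \<psi> u"
    have v: "v \<in> V'" "v \<in> S" "v \<in> V" using W(1)[OF u] V'(3) S(2) by (auto simp: v_def)
    note hS = sm[THEN smooth_on_has_derivative, OF v(2)]
    note h\<psi> = smooth_on_has_derivative[OF \<psi> u]
    have chain: "frechet_derivative X (at u) = (\<lambda>h. x' (frechet_derivative \<psi> (at u) h))"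
      if "(x has_derivative x') (at v)" "\<And>u. X u = x (\<psi> u)" for X :: "real^'n \<Rightarrow> 'z::real_normed_vector" and x x'
    proof -
      have "(X has_derivative (\<lambda>h. x' (frechet_derivative \<psi> (at u) h))) (at u)"
        unfolding that(2)[abs_def] by (rule has_derivative_compose[OF h\<psi>]) (use that(1) in \<open>simp add: v_def\<close>)
      from frechet_derivative_at[OF this] show ?thesis by simp
    qed
    \<comment> \<open>Differentiating \<open>\<psi> (y w) = w\<close> makes the derivative of
      \<open>\<psi>\<close> a left inverse of that of \<open>y\<close>.\<close>
    have \<psi>y: "frechet_derivative \<psi> (at u) (frechet_derivative y (at v) x) = x" for x
    proof -
      have "((\<lambda>w. \<psi> (y w)) has_derivative (\<lambda>h. frechet_derivative \<psi> (at u) (frechet_derivative y (at v) h))) (at v)"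
        by (rule has_derivative_compose[OF hS(1)]) (use h\<psi> W(2)[OF u] in \<open>simp add: v_def\<close>)
      then have "((\<lambda>w. w) has_derivative (\<lambda>h. frechet_derivative \<psi> (at u) (frechet_derivative y (at v) h))) (at v)"
        by (rule has_derivative_transform_within_open[OF _ V'(1) v(1)]) (simp add: y(2))
      from fun_cong[OF has_derivative_unique[OF this has_derivative_ident]] show ?thesis by simp
    qed
    have "p0 differentiable (at v)" "q0 differentiable (at v)"
      using smooth_on_has_derivative[OF sm0(1) v(3)]
        smooth_on_has_derivative[OF sm0(2) v(3)] by (auto simp: differentiable_def)
    moreover have "inj k" unfolding k_def using g(2) by (simp add: bij_betw_inv_into bij_is_inj)
    ultimately have "stable_at (\<lambda>w. k (p0 w)) (\<lambda>w. k (q0 w)) v"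
      by (rule stable_at_linear[OF _ _ k _ stable0[OF v(3)]])
    then have "stable_at (e0_frame y b n) (e3_frame z a m) v" by (simp add: st[OF v(2)])
    \<comment> \<open>Taken along the image of \<open>h\<close> under the derivative of
      \<open>\<psi>\<close>, this gives \<open>l\<close> with \<open>f' h = y' l\<close>. By
      \<open>\<psi>y\<close>, \<open>B'\<close> sends it to \<open>b' l = A' h\<close>, and likewise
      for \<open>N\<close> and \<open>M\<close>.\<close>
    from normal_frame_stable_at[OF hS(1) hS(4) hS(6) hS(2) hS(3) hS(5) inj[OF v(1)] this, of "frechet_derivative \<psi> (at u) h"]
    obtain l where l: "frechet_derivative z (at v) (frechet_derivative \<psi> (at u) h) = frechet_derivative y (at v) l"
      "frechet_derivative a (at v) (frechet_derivative \<psi> (at u) h) = frechet_derivative b (at v) l"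
      "frechet_derivative m (at v) (frechet_derivative \<psi> (at u) h) = frechet_derivative n (at v) l"
      by (elim exE conjE)
    show ?thesis
      unfolding chain[OF hS(2) fBANM(1)] chain[OF hS(4) fBANM(2)] chain[OF hS(3) fBANM(3)]
        chain[OF hS(6) fBANM(4)] chain[OF hS(5) fBANM(5)] l \<psi>y by simp
  qed
  note hW = smW[THEN smooth_on_has_derivative]
  have laws: "additional_conservation_law W f B A" "additional_conservation_law W f N M"
    unfolding additional_conservation_law_def
    by (simp_all add: smW law conservation_law_iff[OF hW(2) hW(3) hW(1)] conservation_law_iff[OF hW(4) hW(5) hW(1)])
  have gen: "generator p q v = g ` system_line f B A N M (y v)" if "v \<in> V'" for v
  proof -
    have "e0_frame y b n v = e0_frame (\<lambda>u. u) B N (y v)" "e3_frame z a m v = e3_frame f A M (y v)"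
      by (simp_all add: e0_frame_def e3_frame_def fBANM y(2)[OF that])
    then have "system_line f B A N M (y v) = span {k (p0 v), k (q0 v)}"
      using sp that V'(3) unfolding system_line_eq_span by auto
    then show ?thesis by (simp add: span_pair_linear_image[OF g(1)] gk gen0)
  qed
  have V'V: "V' \<subseteq> V" using V'(3) S(2) by blast
  have "independent_laws W f B A N M"
  proof (rule independent_laws_of_nondegenerate[OF nd[OF V'(1,2) V'V] g])
    fix v assume "v \<in> V'"
    from gen[OF this] y(1)[OF this] show "\<exists>u\<in>W. generator p q v = g ` system_line f B A N M u" by (rule bexI)
  qed
  then have "system_with_two_laws W f B A N M"
    using V'(4) smW(1) laws by (simp add: system_with_two_laws_def)
  moreover have "generator p q ` V' = (\<lambda>u. g ` system_line f B A N M u) ` W"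
  proof -
    have "W = y ` V'" using V'(5) by (auto simp: homeomorphism_def)
    then show ?thesis using gen by (auto simp: image_iff)
  qed
  ultimately have "hypersurface_of_system V' p q"
    unfolding hypersurface_of_system_def using g
    by - (rule exI[where x = W], rule exI[where x = f], rule exI[where x = B], rule exI[where x = A],
        rule exI[where x = N], rule exI[where x = M], rule exI[where x = g], simp)
  with V'(1,2) V'V show ?thesis by blast
qed

theorem theorem1:
  fixes p q :: "real^'n::finite \<Rightarrow> 'n hcoords"
    and U :: "(real^'n) set" and v0 :: "real^'n"
  assumes "ruled_hypersurface U p q"
    and "v0 \<in> U"
    and "\<And>V. open V \<Longrightarrow> v0 \<in> V \<Longrightarrow> V \<subseteq> U \<Longrightarrow> nondegenerate V p q"
  shows "(\<exists>V. open V \<and> v0 \<in> V \<and> V \<subseteq> U \<and> hypersurface_of_system V p q)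
    \<longleftrightarrow> (\<exists>V. open V \<and> v0 \<in> V \<and> V \<subseteq> U \<and> stable_tangent_spaces V p q)"
proof
  have smooth: "smooth_on V p" "smooth_on V q" if "V \<subseteq> U" for V
    using assms(1) that by (auto simp: ruled_hypersurface_def intro: smooth_on_subset)
  show "\<exists>V. open V \<and> v0 \<in> V \<and> V \<subseteq> U \<and> stable_tangent_spaces V p q"
    if ex: "\<exists>V. open V \<and> v0 \<in> V \<and> V \<subseteq> U \<and> hypersurface_of_system V p q"
  proof -
    obtain V where V: "open V" "v0 \<in> V" "V \<subseteq> U" "hypersurface_of_system V p q" using ex by blast
    from hypersurface_of_system_imp_stable[OF V(1) smooth[OF V(3)] V(4)] V(1-3) show ?thesis by blast
  qed
  show "\<exists>V. open V \<and> v0 \<in> V \<and> V \<subseteq> U \<and> hypersurface_of_system V p q"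
    if ex: "\<exists>V. open V \<and> v0 \<in> V \<and> V \<subseteq> U \<and> stable_tangent_spaces V p q"
  proof -
    obtain V where V: "open V" "v0 \<in> V" "V \<subseteq> U" "stable_tangent_spaces V p q" using ex by blast
    obtain s t where st: "smooth_point p q v0 s t"
      using assms(1,2) by (auto simp: ruled_hypersurface_def)
    have "nondegenerate V' p q" if "open V'" "v0 \<in> V'" "V' \<subseteq> V" for V'
      using assms(3) that V(3) by blast
    from stable_imp_hypersurface_of_system[OF V(1,2) smooth[OF V(3)] V(4) st this]
    show ?thesis using V(3) by blast
  qed
qed

end
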